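(* Let $K$ be a compact subset of $\mathbb{C}$ with nonempty interior, let $M$ be an integer, and let $(Y_n)_{n\ge M}$ be a sequence of mappings defined on $K$ with values in $\mathrm{GL}(2,\mathbb{C})$ which are continuous on $K$ and holomorphic on $\operatorname{int}(K)$. Suppose that for each $n\ge M$, $$Y_n(z)=C_n(z)D_n(z)C_n^{-1}(z),\qquad z\in K,$$ where for every $n\ge M$ the matrix-valued mappings $C_n$ and $D_n$ are continuous on $K$ and holomorphic on $\operatorname{int}(K)$. Assume that (a) $(C_n:n\ge M)\in\mathcal{D}_1(K,\mathrm{Mat}(2,\mathbb{C}))$; (b) for every $n\ge M$ and $z\in K$ one has $D_n(z)=\operatorname{diag}(\lambda_n^+(z),\lambda_n^-(z))$ with $|\lambda_n^+(z)|\ge|\lambda_n^-(z)|$; (c) there exist mappings $C_\infty$ and $D_\infty$ defined on $K$ with values in $\mathrm{GL}(2,\mathbb{C})$ such that $\lim_{n\to\infty}\sup_K\|C_n-C_\infty\|=0$ and $\lim_{n\to\infty}\sup_K\|D_n-D_\infty\|=0$. If $$\inf_{z\in K}\prod_{n=M}^\infty\Big|\frac{\lambda_n^+(z)}{\lambda_n^-(z)}\Big|=\infty\qquad\text{or}\qquad\sup_{z\in K}\prod_{n=M}^\infty\Big|\frac{\lambda_n^+(z)}{\lambda_n^-(z)}\Big|<\infty,$$ then there exist sequences $(\Phi_n^-:n\ge M)$ and $(\Phi_n^+:n\ge M)$ of mappings defined on $K$ with values in $\mathbb{C}^2$ such that (1) for each $n\ge M$, $\Phi_n^-$ and $\Phi_n^+$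 are holomorphic in $\operatorname{int}(K)$ and continuous on $K$; (2) for each $z\in K$, the sequences $(\Phi_n^-(z):n\ge M)$ and $(\Phi_n^+(z):n\ge M)$ are linearly independent solutions of $\Phi_{n+1}(z)=Y_n(z)\Phi_n(z)$, $n\ge M$; (3) $$\lim_{n\to\infty}\sup_{z\in K}\Big\|\frac{\Phi_n^+(z)}{\prod_{j=M}^{n-1}\lambda_j^+(z)}-C_\infty(z)e_1\Big\|=0\quad\text{and}\quad\lim_{n\to\infty}\sup_{z\in K}\Big\|\frac{\Phi_n^-(z)}{\prod_{j=M}^{n-1}\lambda_j^-(z)}-C_\infty(z)e_2\Big\|=0 .$$
   Context: $e_1,e_2$ is the standard basis of $\mathbb{C}^2$. A sequence $(C_n)_{n\ge M}$ of continuous mappings from $K$ to $\mathrm{Mat}(2,\mathbb{C})$ (the $2\times2$ complex matrices) belongs to $\mathcal{D}_1(K,\mathrm{Mat}(2,\mathbb{C}))$ if it is uniformly bounded and $\sum_{n\ge M}\sup_{z\in K}\|C_{n+1}(z)-C_n(z)\|<\infty$. *)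

theory Defs
  imports "HOL-Analysis.Analysis"
begin

text \<open>Sequences \<open>(a_n : n \<ge> M)\<close> with an integer \<open>M\<close> are functions on \<^typ>\<open>int\<close> of which only the
  values at indices \<open>n \<ge> M\<close> are ever used.\<close>

definition vec_holomorphic_on :: "(complex \<Rightarrow> complex^2) \<Rightarrow> complex set \<Rightarrow> bool" where
  "vec_holomorphic_on f S \<longleftrightarrow> (\<forall>i. (\<lambda>z. f z $ i) holomorphic_on S)"

definition mat_holomorphic_on :: "(complex \<Rightarrow> complex^2^2) \<Rightarrow> complex set \<Rightarrow> bool" where
  "mat_holomorphic_on F S \<longleftrightarrow> (\<forall>i j. (\<lambda>z. F z $ i $ j) holomorphic_on S)"

text \<open>The supremum of the norm over \<open>K\<close>, with value \<open>\<infinity>\<close> for unbounded mappings. The norm on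
  \<^typ>\<open>complex^2^2\<close> is the Frobenius norm; as all norms on this finite-dimensional space are
  equivalent, the choice affects none of the notions below.\<close>

definition sup_norm :: "complex set \<Rightarrow> (complex \<Rightarrow> 'a::real_normed_vector) \<Rightarrow> ennreal" where
  "sup_norm K f = (SUP z\<in>K. ennreal (norm (f z)))"

definition D1 :: "int \<Rightarrow> complex set \<Rightarrow> (int \<Rightarrow> complex \<Rightarrow> 'a::real_normed_vector) \<Rightarrow> bool" where
  "D1 M K C \<longleftrightarrow>
     (\<forall>n\<ge>M. continuous_on K (C n)) \<and>
     (\<exists>B::real. \<forall>n\<ge>M. \<forall>z\<in>K. norm (C n z) \<le> B) \<and>
     (\<Sum>k. sup_norm K (\<lambda>z. C (M + int k + 1) z - C (M + int k) z)) < \<infinity>"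

definition diag2 :: "complex \<Rightarrow> complex \<Rightarrow> complex^2^2" where
  "diag2 a b = vector [vector [a, 0], vector [0, b]]"

definition solution_from ::
    "int \<Rightarrow> (int \<Rightarrow> complex^2^2) \<Rightarrow> (int \<Rightarrow> complex^2) \<Rightarrow> bool" where
  "solution_from M A u \<longleftrightarrow> (\<forall>n\<ge>M. u (n + 1) = A n *v u n)"

text \<open>Linear independence over \<open>\<complex>\<close> of two sequences, as elements of the space of
  \<open>\<complex>\<^sup>2\<close>-valued sequences indexed by \<open>n \<ge> M\<close>.\<close>

definition lin_indep_from :: "int \<Rightarrow> (int \<Rightarrow> complex^2) \<Rightarrow> (int \<Rightarrow> complex^2) \<Rightarrow> bool" where
  "lin_indep_from M u v \<longleftrightarrow>
     (\<forall>a b. (\<forall>n\<ge>M. a *s u n + b *s v n = 0) \<longrightarrow> a = 0 \<and> b = 0)"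

text \<open>The library's infinite product taken in \<^typ>\<open>ennreal\<close>: for factors \<open>\<ge> 1\<close> it always
  exists, and it is \<open>\<infinity>\<close> when the partial products are unbounded.\<close>

definition ratio_prod ::
    "int \<Rightarrow> (int \<Rightarrow> complex \<Rightarrow> complex) \<Rightarrow> (int \<Rightarrow> complex \<Rightarrow> complex) \<Rightarrow> complex \<Rightarrow> ennreal" where
  "ratio_prod M p q z = (\<Prod>k. ennreal (norm (p (M + int k) z / q (M + int k) z)))"

end

theory Submission
  imports Defs "HOL-Complex_Analysis.Cauchy_Integral_Formula"
begin

text \<open>
  This is a discrete Levinson theorem with a holomorphic parameter. Substituting
  \<open>\<Phi>\<^sub>n = (\<Prod>j<n. \<lambda>\<^sub>j) C\<^sub>n y\<^sub>n\<close>, with \<open>\<lambda> = \<lambda>\<^sup>+\<close> or \<open>\<lambda> = \<lambda>\<^sup>-\<close>, turns the equation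
  into \<open>\<lambda>\<^sub>n C\<^sub>n\<^sub>+\<^sub>1 y\<^sub>n\<^sub>+\<^sub>1 = C\<^sub>n D\<^sub>n y\<^sub>n\<close>. Since \<open>C\<^sub>n\<close> converges uniformly to an invertible limit,
  the inverses of the \<open>C\<^sub>n\<close> are uniformly bounded, so \<open>C\<^sub>n\<^sup>-\<^sup>1 C\<^sub>n\<^sub>+\<^sub>1\<close> differs from the identity by an
  error whose supremum over \<open>K\<close> is summable. One has to find \<open>y\<^sub>n \<rightarrow> e\<^sub>1\<close> for \<open>\<lambda>\<^sup>+\<close> and
  \<open>y\<^sub>n \<rightarrow> e\<^sub>2\<close> for \<open>\<lambda>\<^sup>-\<close>, uniformly on \<open>K\<close>.

  For \<open>\<lambda>\<^sup>-\<close> the equation is solved backwards: \<open>y\<^sub>n = B\<^sub>n y\<^sub>n\<^sub>+\<^sub>1\<close>, where \<open>B\<^sub>n\<close> is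
  \<open>diag(\<lambda>\<^sup>-/\<lambda>\<^sup>+, 1)\<close> times a perturbation of the identity. The entries of the diagonal factor have
  modulus at most 1, and the errors are summable, so all products \<open>B\<^sub>n \<cdots> B\<^sub>n\<^sub>+\<^sub>m\<close> are
  uniformly bounded; as the norms of \<open>B\<^sub>k e\<^sub>2 - e\<^sub>2\<close> are summable in \<open>k\<close>, the vectors
  \<open>B\<^sub>n \<cdots> B\<^sub>n\<^sub>+\<^sub>m e\<^sub>2\<close> are the partial sums of a uniformly convergent telescoping series, and
  their limit is \<open>y\<^sub>n\<close> (\<open>backward_products_converge\<close>, \<open>recessive_solution\<close>). If the products of
  \<open>\<bar>\<lambda>\<^sup>+/\<lambda>\<^sup>-\<bar>\<close> are bounded on \<open>K\<close>, the same argument applies to \<open>\<lambda>\<^sup>+\<close>, with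
  \<open>diag(1, \<lambda>\<^sup>+/\<lambda>\<^sup>-)\<close> as diagonal factor (\<open>dominant_solution_if_bounded\<close>).

  If those products diverge everywhere on \<open>K\<close>, they do so uniformly by Dini's theorem
  (\<open>decreasing_to_zero_uniformly\<close>). The solution for \<open>\<lambda>\<^sup>+\<close> that starts from \<open>e\<^sub>1\<close> at a late index \<open>N\<close>
  then loses its second component, while its first component tends to a function \<open>g\<close> close to 1,
  because the total error after \<open>N\<close> is small (\<open>dominant_component\<close>). Dividing by \<open>g\<close> and continuing
  the solution back to the first index gives the required sequence
  (\<open>dominant_solution_if_unbounded\<close>).

  Every \<open>y\<^sub>n\<close> arises from holomorphic data by finitely many algebraic operations and one uniform
  limit, hence is continuous on \<open>K\<close> and holomorphic inside. Linear independence can be read off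
  from the limits \<open>e\<^sub>1\<close> and \<open>e\<^sub>2\<close>, because the product of the \<open>\<lambda>\<^sup>+\<close> dominates that of the
  \<open>\<lambda>\<^sup>-\<close> (\<open>normalised_solutions_independent\<close>).
\<close>

section \<open>Vectors and matrices of size two\<close>

text \<open>The norm of a matrix is the Frobenius norm, so this is the Cauchy--Schwarz inequality for
  each row.\<close>

lemma norm_matrix_vector_mult_le:
  fixes A :: "complex^'n^'m"
  shows "norm (A *v x) \<le> norm A * norm x"
proof -
  have row: "norm ((A *v x) $ i) \<le> norm (A $ i) * norm x" for i
  proof -
    have "norm ((A *v x) $ i) \<le> (\<Sum>j\<in>UNIV. norm (A $ i $ j * x $ j))"
      unfolding matrix_vector_mult_def by (simp add: norm_sum)
    also have "\<dots> = (\<Sum>j\<in>UNIV. \<bar>norm (A $ i $ j)\<bar> * \<bar>norm (x $ j)\<bar>)"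
      by (simp add: norm_mult)
    also have "\<dots> \<le> norm (A $ i) * norm x"
      unfolding norm_vec_def by (rule L2_set_mult_ineq)
    finally show ?thesis .
  qed
  have "norm (A *v x) \<le> L2_set (\<lambda>i. norm (A $ i) * norm x) UNIV"
    unfolding norm_vec_def[of "A *v x"] by (intro L2_set_mono row) auto
  also have "\<dots> = norm A * norm x"
    unfolding norm_vec_def[of A] by (simp add: L2_set_left_distrib)
  finally show ?thesis .
qed

lemma norm_vector_smult_complex: "norm (a *s v) = norm a * norm (v :: complex^'n)"
  by (simp add: norm_vec_def norm_mult L2_set_right_distrib)

lemma bounded_bilinear_matrix_vector_mult:
  "bounded_bilinear ((*v) :: complex^'n^'m \<Rightarrow> complex^'n \<Rightarrow> complex^'m)"
proof
  show "\<exists>B. \<forall>A x. norm ((A :: complex^'n^'m) *v x) \<le> norm A * norm x * B"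
    using norm_matrix_vector_mult_le by (metis mult.right_neutral)
qed (simp_all add: matrix_vector_mult_add_rdistrib matrix_vector_right_distrib vec_eq_iff
    matrix_vector_mult_def scaleR_sum_right sum.distrib ring_distribs)

lemmas bounded_linear_matrix_vector_mult =
  bounded_bilinear.bounded_linear_right[OF bounded_bilinear_matrix_vector_mult]

lemma matrix_vector_mult_2:
  fixes A :: "complex^2^2"
  shows "A *v x = vector [A $ 1 $ 1 * x $ 1 + A $ 1 $ 2 * x $ 2, A $ 2 $ 1 * x $ 1 + A $ 2 $ 2 * x $ 2]"
  by (simp add: vec_eq_iff forall_2 matrix_vector_mult_def sum_2)

lemma diag2_mult_vec: "diag2 a b *v x = vector [a * x $ 1, b * x $ 2]"
  by (simp add: matrix_vector_mult_2 diag2_def)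

lemma norm_le_sum_components: "norm (x :: complex^2) \<le> norm (x $ 1) + norm (x $ 2)"
  using L2_set_le_sum[of UNIV "\<lambda>i. norm (x $ i)"] by (simp add: norm_vec_def sum_2)

lemma norm_diag2_mult_vec_le:
  assumes "norm a \<le> s" "norm b \<le> s"
  shows "norm (diag2 a b *v x) \<le> s * norm x"
proof -
  have "norm ((diag2 a b *v x) $ i) \<le> s * norm (x $ i)" for i
    using exhaust_2[of i] assms by (auto simp: diag2_mult_vec norm_mult intro!: mult_right_mono)
  then have "norm (diag2 a b *v x) \<le> L2_set (\<lambda>i. s * norm (x $ i)) UNIV"
    unfolding norm_vec_def[of "diag2 a b *v x"] by (intro L2_set_mono) auto
  also have "\<dots> = s * norm x"
    using order_trans[OF norm_ge_zero assms(1)] unfolding norm_vec_def[of x]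
    by (simp add: L2_set_right_distrib)
  finally show ?thesis .
qed

lemma matrix_inv_is_inverse:
  fixes A :: "complex^'n^'n"
  assumes "invertible A"
  shows "A ** matrix_inv A = mat 1" "matrix_inv A ** A = mat 1"
  using someI_ex[OF assms[unfolded invertible_def]] unfolding matrix_inv_def by auto

lemma matrix_inv_2:
  fixes A :: "complex^2^2"
  assumes "invertible A"
  shows "matrix_inv A =
    vector [vector [A $ 2 $ 2 / det A, - A $ 1 $ 2 / det A],
            vector [- A $ 2 $ 1 / det A, A $ 1 $ 1 / det A]]" (is "_ = ?B")
proof -
  have d: "det A \<noteq> 0"
    using assms by (simp add: invertible_det_nz)
  have "A ** ?B = mat 1"
    using d by (simp add: vec_eq_iff forall_2 matrix_matrix_mult_def sum_2 mat_def field_simps)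
       (simp add: det_2 algebra_simps)
  then have "matrix_inv A ** (A ** ?B) = matrix_inv A"
    by simp
  moreover have "matrix_inv A ** A = mat 1"
    using assms by (rule matrix_inv_is_inverse)
  ultimately show ?thesis
    by (simp add: matrix_mul_assoc)
qed

text \<open>The adjugate of a \<open>2 \<times> 2\<close> matrix has the same entries up to order and sign, hence the same
  Frobenius norm. A lower bound for determinants therefore bounds the inverses.\<close>

lemma norm_matrix_inv_2:
  fixes A :: "complex^2^2"
  assumes "invertible A"
  shows "norm (matrix_inv A) = norm A / norm (det A)"
proof -
  have N: "norm M = sqrt ((norm (M $ 1 $ 1))\<^sup>2 + (norm (M $ 1 $ 2))\<^sup>2
      + ((norm (M $ 2 $ 1))\<^sup>2 + (norm (M $ 2 $ 2))\<^sup>2))" for M :: "complex^2^2"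
    by (simp add: norm_vec_def L2_set_def sum_2)
  have "sqrt ((x / c)\<^sup>2 + (y / c)\<^sup>2 + ((u / c)\<^sup>2 + (v / c)\<^sup>2)) = sqrt (v\<^sup>2 + y\<^sup>2 + (u\<^sup>2 + x\<^sup>2)) / c"
    if "c \<ge> 0" for x y u v c :: real
  proof -
    have "(x / c)\<^sup>2 + (y / c)\<^sup>2 + ((u / c)\<^sup>2 + (v / c)\<^sup>2) = (v\<^sup>2 + y\<^sup>2 + (u\<^sup>2 + x\<^sup>2)) / c\<^sup>2"
      by (simp add: power_divide add_divide_distrib)
    with that show ?thesis by (simp only: real_sqrt_divide real_sqrt_abs abs_of_nonneg)
  qed
  then show ?thesis
    unfolding N matrix_inv_2[OF assms] by (simp add: norm_divide)
qed

lemma matrix_inv_cancel: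
  fixes A :: "complex^'n^'n"
  assumes "invertible A"
  shows "matrix_inv A *v (A *v v) = v" "A *v (matrix_inv A *v v) = v"
  using matrix_inv_is_inverse[OF assms]
  by (simp_all add: matrix_vector_mul_assoc)

lemma invertible_diag2: "invertible (diag2 a b) \<longleftrightarrow> a \<noteq> 0 \<and> b \<noteq> 0"
  by (simp add: invertible_det_nz det_2 diag2_def)

section \<open>Functions continuous on a set and holomorphic in its interior\<close>

text \<open>The functions that are continuous on \<open>K\<close> and holomorphic in its interior form an algebra that
  is closed under uniform limits and under division by functions without zeros on \<open>K\<close>; all
  constructions below stay inside it.\<close>

definition hol_cont :: "complex set \<Rightarrow> (complex \<Rightarrow> complex) \<Rightarrow> bool" where
  "hol_cont K f \<longleftrightarrow> continuous_on K f \<and> f holomorphic_on interior K"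

lemma hol_cont_const [simp]: "hol_cont K (\<lambda>z. a)"
  by (simp add: hol_cont_def)

lemma hol_cont_add: "hol_cont K f \<Longrightarrow> hol_cont K g \<Longrightarrow> hol_cont K (\<lambda>z. f z + g z)"
  by (simp add: hol_cont_def continuous_on_add holomorphic_on_add)

lemma hol_cont_diff: "hol_cont K f \<Longrightarrow> hol_cont K g \<Longrightarrow> hol_cont K (\<lambda>z. f z - g z)"
  by (simp add: hol_cont_def continuous_on_diff holomorphic_on_diff)

lemma hol_cont_mult: "hol_cont K f \<Longrightarrow> hol_cont K g \<Longrightarrow> hol_cont K (\<lambda>z. f z * g z)"
  by (simp add: hol_cont_def continuous_on_mult holomorphic_on_mult)

lemma hol_cont_minus: "hol_cont K f \<Longrightarrow> hol_cont K (\<lambda>z. - f z)"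
  by (simp add: hol_cont_def continuous_on_minus holomorphic_on_minus)

lemma hol_cont_divide:
  "hol_cont K f \<Longrightarrow> hol_cont K g \<Longrightarrow> (\<And>z. z \<in> K \<Longrightarrow> g z \<noteq> 0) \<Longrightarrow> hol_cont K (\<lambda>z. f z / g z)"
  unfolding hol_cont_def using interior_subset
  by (auto intro!: continuous_on_divide holomorphic_on_divide)

lemma hol_cont_prod: "(\<And>j. j \<in> J \<Longrightarrow> hol_cont K (f j)) \<Longrightarrow> hol_cont K (\<lambda>z. \<Prod>j\<in>J. f j z)"
  by (induction J rule: infinite_finite_induct) (auto intro: hol_cont_mult)

lemma hol_cont_cong:
  assumes "\<And>z. z \<in> K \<Longrightarrow> f z = g z"
  shows "hol_cont K f \<longleftrightarrow> hol_cont K g"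
proof -
  have "f holomorphic_on interior K \<longleftrightarrow> g holomorphic_on interior K"
    using assms interior_subset by (intro holomorphic_cong) auto
  with assms show ?thesis
    unfolding hol_cont_def by (simp cong: continuous_on_cong)
qed

lemma hol_cont_uniform_limit:
  assumes "\<And>n. hol_cont K (f n)" and lim: "uniform_limit K f g sequentially"
  shows "hol_cont K g"
  unfolding hol_cont_def
proof
  show "continuous_on K g"
    using assms by (intro uniform_limit_theorem[OF _ lim]) (auto simp: hol_cont_def)
  show "g holomorphic_on interior K"
  proof (rule holomorphic_uniform_sequence)
    fix x assume "x \<in> interior K"
    then obtain d where "d > 0" "cball x d \<subseteq> interior K"
      using open_contains_cball open_interior by blast
    then show "\<exists>d>0. cball x d \<subseteq> interior K \<and> uniform_limit (cball x d) f g sequentially"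
      using interior_subset by (meson lim order_trans uniform_limit_on_subset)
  qed (use assms(1) in \<open>simp_all add: hol_cont_def\<close>)
qed

definition hol_cont_vec :: "complex set \<Rightarrow> (complex \<Rightarrow> complex^2) \<Rightarrow> bool" where
  "hol_cont_vec K v \<longleftrightarrow> (\<forall>i. hol_cont K (\<lambda>z. v z $ i))"

definition hol_cont_mat :: "complex set \<Rightarrow> (complex \<Rightarrow> complex^2^2) \<Rightarrow> bool" where
  "hol_cont_mat K A \<longleftrightarrow> (\<forall>i j. hol_cont K (\<lambda>z. A z $ i $ j))"

lemma hol_cont_vec_iff: "hol_cont_vec K v \<longleftrightarrow> continuous_on K v \<and> vec_holomorphic_on v (interior K)"
proof -
  have "continuous_on K v \<longleftrightarrow> (\<forall>i. continuous_on K (\<lambda>z. v z $ i))"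
    using continuous_on_component[of K v] continuous_on_vec_lambda[of K "\<lambda>i z. v z $ i"]
    by auto
  then show ?thesis
    unfolding hol_cont_vec_def hol_cont_def vec_holomorphic_on_def by blast
qed

lemma hol_cont_matI: "continuous_on K A \<Longrightarrow> mat_holomorphic_on A (interior K) \<Longrightarrow> hol_cont_mat K A"
  unfolding hol_cont_mat_def hol_cont_def mat_holomorphic_on_def
  by (auto intro!: continuous_on_component)

lemma hol_cont_vec_const [simp]: "hol_cont_vec K (\<lambda>z. v)"
  by (simp add: hol_cont_vec_def)

lemma hol_cont_vec_mult:
  "hol_cont_mat K A \<Longrightarrow> hol_cont_vec K v \<Longrightarrow> hol_cont_vec K (\<lambda>z. A z *v v z)"
  unfolding hol_cont_vec_def hol_cont_mat_def
  by (simp add: forall_2 matrix_vector_mult_2 hol_cont_add hol_cont_mult)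

lemma hol_cont_vec_scale:
  "hol_cont K f \<Longrightarrow> hol_cont_vec K v \<Longrightarrow> hol_cont_vec K (\<lambda>z. f z *s v z)"
  unfolding hol_cont_vec_def by (auto intro!: hol_cont_mult)

lemma hol_cont_vec_uniform_limit:
  assumes "\<And>n. hol_cont_vec K (f n)" "uniform_limit K f g sequentially"
  shows "hol_cont_vec K g"
  unfolding hol_cont_vec_def
proof
  fix i
  have lim: "uniform_limit K (\<lambda>n z. f n z $ i) (\<lambda>z. g z $ i) sequentially"
    by (rule bounded_linear.uniform_limit[OF bounded_linear_vec_nth assms(2)])
  show "hol_cont K (\<lambda>z. g z $ i)"
    using assms(1) by (intro hol_cont_uniform_limit[OF _ lim]) (simp add: hol_cont_vec_def)
qed

lemma hol_cont_mat_diag2: "hol_cont K a \<Longrightarrow> hol_cont K b \<Longrightarrow> hol_cont_mat K (\<lambda>z. diag2 (a z) (b z))"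
  by (simp add: hol_cont_mat_def forall_2 diag2_def)

lemma hol_cont_det: "hol_cont_mat K A \<Longrightarrow> hol_cont K (\<lambda>z. det (A z))"
  unfolding hol_cont_mat_def by (simp add: det_2 hol_cont_diff hol_cont_mult)

lemma hol_cont_mat_inv:
  assumes A: "hol_cont_mat K A" and inv: "\<And>z. z \<in> K \<Longrightarrow> invertible (A z)"
  shows "hol_cont_mat K (\<lambda>z. matrix_inv (A z))"
proof -
  let ?B = "\<lambda>z. vector [vector [A z $ 2 $ 2 / det (A z), - A z $ 1 $ 2 / det (A z)],
            vector [- A z $ 2 $ 1 / det (A z), A z $ 1 $ 1 / det (A z)]] :: complex^2^2"
  have "hol_cont_mat K ?B"
    using A hol_cont_det[OF A] inv unfolding hol_cont_mat_def
    by (auto simp: forall_2 invertible_det_nz intro!: hol_cont_divide hol_cont_minus)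
  moreover have "hol_cont K (\<lambda>z. matrix_inv (A z) $ i $ j) \<longleftrightarrow> hol_cont K (\<lambda>z. ?B z $ i $ j)" for i j
    by (intro hol_cont_cong) (simp add: matrix_inv_2[OF inv])
  ultimately show ?thesis
    unfolding hol_cont_mat_def by simp
qed

section \<open>Uniform convergence on compact sets\<close>

text \<open>By compactness the limit has a positive minimum modulus, which settles all late indices; each
  of the finitely many remaining functions has a positive minimum modulus of its own.\<close>

lemma uniform_limit_bounded_below:
  fixes f :: "nat \<Rightarrow> complex \<Rightarrow> complex"
  assumes K: "compact K" and lim: "uniform_limit K f g sequentially"
    and cont: "\<And>n. continuous_on K (f n)" and nz: "\<And>n z. z \<in> K \<Longrightarrow> f n z \<noteq> 0" "\<And>z. z \<in> K \<Longrightarrow> g z \<noteq> 0"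
  obtains \<delta> where "\<delta> > 0" "\<And>n z. z \<in> K \<Longrightarrow> \<delta> \<le> norm (f n z)"
proof -
  have low: "\<exists>\<delta>>0. \<forall>z\<in>K. \<delta> \<le> norm (h z)"
    if "continuous_on K h" "\<And>z. z \<in> K \<Longrightarrow> h z \<noteq> 0" for h :: "complex \<Rightarrow> complex"
  proof (cases "K = {}")
    case False
    have "continuous_on K (\<lambda>z. norm (h z))"
      using that(1) by (rule continuous_on_norm)
    from continuous_attains_inf[OF K False this]
    obtain z0 where "z0 \<in> K" "\<And>z. z \<in> K \<Longrightarrow> norm (h z0) \<le> norm (h z)"
      by blast
    with that(2) show ?thesis by (intro exI[of _ "norm (h z0)"]) auto
  qed (auto intro: exI[of _ 1])
  have "continuous_on K g"
    using cont by (intro uniform_limit_theorem[OF _ lim]) auto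
  from low[OF this nz(2)] obtain d where d: "d > 0" "\<And>z. z \<in> K \<Longrightarrow> d \<le> norm (g z)" by blast
  have "\<forall>\<^sub>F n in sequentially. \<forall>z\<in>K. dist (f n z) (g z) < d / 2"
    using lim half_gt_zero[OF d(1)] unfolding uniform_limit_iff by blast
  then obtain N where N: "\<And>n z. n \<ge> N \<Longrightarrow> z \<in> K \<Longrightarrow> dist (f n z) (g z) < d / 2"
    unfolding eventually_sequentially by blast
  have "\<forall>n. \<exists>\<delta>>0. \<forall>z\<in>K. \<delta> \<le> norm (f n z)"
    using low cont nz(1) by blast
  then obtain \<delta> where \<delta>: "\<And>n. \<delta> n > 0" "\<And>n z. z \<in> K \<Longrightarrow> \<delta> n \<le> norm (f n z)" by metis
  define \<mu> where "\<mu> = Min (insert (d / 2) (\<delta> ` {..<N}))"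
  show thesis
  proof
    show "\<mu> > 0" using d(1) \<delta>(1) by (simp add: \<mu>_def)
    fix n z assume z: "z \<in> K"
    show "\<mu> \<le> norm (f n z)"
    proof (cases "n < N")
      case True
      then have "\<mu> \<le> \<delta> n" unfolding \<mu>_def by (intro Min_le) auto
      with \<delta>(2)[OF z, of n] show ?thesis by linarith
    next
      case False
      have "\<mu> \<le> d / 2" unfolding \<mu>_def by (intro Min_le) auto
      moreover have "norm (g z) - norm (f n z) \<le> dist (f n z) (g z)"
        by (metis dist_commute dist_norm norm_triangle_ineq2)
      ultimately show ?thesis using N[of n z] False z d(2)[OF z] by linarith
    qed
  qed
qed

text \<open>Dini's theorem: the sets on which \<open>f n \<ge> \<epsilon>\<close> are compact and nested, and a common point would
  violate pointwise convergence, so one of them is empty.\<close>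

lemma decreasing_to_zero_uniformly:
  fixes f :: "nat \<Rightarrow> 'a::heine_borel \<Rightarrow> real"
  assumes "compact K" "\<And>n. continuous_on K (f n)" "\<And>n z. z \<in> K \<Longrightarrow> f (Suc n) z \<le> f n z"
    "\<And>z. z \<in> K \<Longrightarrow> (\<lambda>n. f n z) \<longlonglongrightarrow> 0" and \<epsilon>: "\<epsilon> > 0"
  shows "\<exists>n0. \<forall>n\<ge>n0. \<forall>z\<in>K. f n z < \<epsilon>"
proof (rule ccontr)
  assume *: "\<not> ?thesis"
  have mono: "f n z \<le> f m z" if "m \<le> n" "z \<in> K" for m n z
    using that(1) by (rule lift_Suc_antimono_le[of "\<lambda>n. f n z", rotated]) (use assms(3) that(2) in auto)
  define A where "A n = {z \<in> K. \<epsilon> \<le> f n z}" for n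
  have "\<Inter>(range A) \<noteq> {}"
  proof (rule compact_nest)
    show "compact (A n)" for n :: nat
    proof -
      have "closedin (top_of_set K) (K \<inter> f n -` {\<epsilon>..})"
        using assms(2) by (intro continuous_closedin_preimage) auto
      moreover have "A n = K \<inter> f n -` {\<epsilon>..}" by (auto simp: A_def)
      ultimately show ?thesis using assms(1) closedin_compact by metis
    qed
    show "A n \<noteq> {}" for n :: nat
    proof -
      obtain m z where "m \<ge> n" "z \<in> K" "\<epsilon> \<le> f m z" using * by (meson not_less)
      then show ?thesis using mono[of n m z] by (auto simp: A_def intro: exI[of _ z])
    qed
    show "A n \<subseteq> A m" if "m \<le> n" for m n :: nat
      using mono[OF that] by (force simp: A_def)
  qed
  then obtain z where z: "\<And>n. z \<in> A n" by blast
  then have "\<forall>n. \<epsilon> \<le> f n z" "z \<in> K" by (auto simp: A_def)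
  then have "\<epsilon> \<le> 0" using LIMSEQ_le_const[OF assms(4)] by blast
  with \<epsilon> show False by simp
qed

lemma sup_norm_tendsto_0_iff:
  fixes f :: "'i \<Rightarrow> complex \<Rightarrow> 'a::real_normed_vector"
  shows "((\<lambda>n. sup_norm K (\<lambda>z. f n z - g z)) \<longlongrightarrow> 0) F \<longleftrightarrow> uniform_limit K f g F"
proof
  assume L: "((\<lambda>n. sup_norm K (\<lambda>z. f n z - g z)) \<longlongrightarrow> 0) F"
  show "uniform_limit K f g F"
    unfolding uniform_limit_iff
  proof (intro allI impI)
    fix e :: real assume "e > 0"
    then have "\<forall>\<^sub>F n in F. sup_norm K (\<lambda>z. f n z - g z) < ennreal e"
      using order_tendstoD(2)[OF L, of "ennreal e"] by simp
    then show "\<forall>\<^sub>F n in F. \<forall>z\<in>K. dist (f n z) (g z) < e"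
    proof eventually_elim
      case (elim n)
      show ?case
      proof
        fix z assume "z \<in> K"
        then have "ennreal (norm (f n z - g z)) \<le> sup_norm K (\<lambda>z. f n z - g z)"
          unfolding sup_norm_def by (rule SUP_upper)
        then have "ennreal (norm (f n z - g z)) < ennreal e" using elim by (rule order_le_less_trans)
        then show "dist (f n z) (g z) < e" by (simp add: ennreal_less_iff dist_norm)
      qed
    qed
  qed
next
  assume U: "uniform_limit K f g F"
  show "((\<lambda>n. sup_norm K (\<lambda>z. f n z - g z)) \<longlongrightarrow> 0) F"
  proof (rule order_tendstoI)
    fix a :: ennreal assume "0 < a"
    then obtain b where b: "0 < b" "b < a" using dense by blast
    then obtain e where e: "b = ennreal e" "e > 0"
      by (cases b) (auto simp: ennreal_zero_less_top)
    have "\<forall>\<^sub>F n in F. \<forall>z\<in>K. dist (f n z) (g z) < e" using U e by (simp add: uniform_limit_iff)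
    then show "\<forall>\<^sub>F n in F. sup_norm K (\<lambda>z. f n z - g z) < a"
    proof eventually_elim
      case (elim n)
      then have "sup_norm K (\<lambda>z. f n z - g z) \<le> ennreal e"
        unfolding sup_norm_def by (intro SUP_least) (simp add: dist_norm ennreal_leI less_imp_le)
      with b e show ?case by (simp add: order_le_less_trans)
    qed
  qed simp
qed

text \<open>The partial products increase, so in \<^typ>\<open>ennreal\<close> they converge to their supremum, possibly
  \<open>\<infinity>\<close>. As this supremum is at least 1 and no factor vanishes, it is also the infinite product,
  whose definition demands a nonzero limit when no factor vanishes.\<close>

lemma prodinf_ennreal_ge_1:
  fixes f :: "nat \<Rightarrow> real"
  assumes f: "\<And>i. 1 \<le> f i"
  shows "(\<lambda>n. ennreal (\<Prod>i<n. f i)) \<longlonglongrightarrow> (\<Prod>i. ennreal (f i))"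
    and "ennreal (\<Prod>i<n. f i) \<le> (\<Prod>i. ennreal (f i))"
proof -
  let ?P = "\<lambda>n. ennreal (\<Prod>i<n. f i)"
  have P: "(\<Prod>i<n. ennreal (f i)) = ?P n" for n
    using f by (intro prod_ennreal) (meson order_trans zero_le_one)
  have pos: "0 \<le> (\<Prod>i<n. f i)" for n
    using f by (intro prod_nonneg) (meson order_trans zero_le_one)
  have inc: "incseq ?P"
  proof (rule incseq_SucI)
    fix n
    show "?P n \<le> ?P (Suc n)"
      using mult_right_mono[OF f[of n] pos[of n]] by (simp add: ennreal_leI mult.commute)
  qed
  have lim: "?P \<longlonglongrightarrow> (SUP n. ?P n)"
    by (rule LIMSEQ_SUP[OF inc])
  then have lim': "(\<lambda>n. \<Prod>i\<le>n. ennreal (f i)) \<longlonglongrightarrow> (SUP n. ?P n)"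
    unfolding P[symmetric] by (simp only: LIMSEQ_lessThan_iff_atMost[of "\<lambda>S. \<Prod>i\<in>S. ennreal (f i)"])
  have "?P 0 \<le> (SUP n. ?P n)"
    by (rule SUP_upper) simp
  then have nz: "(SUP n. ?P n) \<noteq> 0" by (auto simp: not_le)
  have fnz: "ennreal (f i) \<noteq> 0" for i using f[of i] by (simp add: not_le)
  have "(\<Prod>i. ennreal (f i)) = (SUP n. ?P n)"
    unfolding prodinf_def has_prod_def raw_has_prod_def
    using lim' nz fnz by (intro the_equality) (auto intro: LIMSEQ_unique)
  with lim show "?P \<longlonglongrightarrow> (\<Prod>i. ennreal (f i))" "?P n \<le> (\<Prod>i. ennreal (f i))"
    by (auto intro: SUP_upper)
qed

section \<open>Infinite products of linear maps\<close>

text \<open>\<open>backward B n m\<close> is the composition \<open>B\<^sub>n \<circ> B\<^sub>n\<^sub>+\<^sub>1 \<circ> \<cdots> \<circ> B\<^sub>n\<^sub>+\<^sub>m\<^sub>-\<^sub>1\<close>.\<close>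

primrec backward :: "(nat \<Rightarrow> 'a \<Rightarrow> 'a) \<Rightarrow> nat \<Rightarrow> nat \<Rightarrow> 'a \<Rightarrow> 'a" where
  "backward B n 0 v = v"
| "backward B n (Suc m) v = B n (backward B (Suc n) m v)"

lemma backward_Suc_inner: "backward B n (Suc m) v = backward B n m (B (n + m) v)"
  by (induction m arbitrary: n) simp_all

lemma backward_diff:
  fixes B :: "nat \<Rightarrow> 'a::real_vector \<Rightarrow> 'a"
  assumes "\<And>n. linear (B n)"
  shows "backward B n m (u - v) = backward B n m u - backward B n m v"
  by (induction m arbitrary: n) (simp_all add: linear_diff[OF assms])

lemma prod_one_plus_le_exp_suminf:
  fixes e :: "nat \<Rightarrow> real"
  assumes "summable e" "\<And>n. 0 \<le> e n"
  shows "(\<Prod>i<m. 1 + e (n + i)) \<le> exp (suminf e)"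
proof -
  have "(\<Prod>i<m. 1 + e (n + i)) \<le> (\<Prod>i<m. exp (e (n + i)))"
    using assms(2) by (intro prod_mono) (auto simp: add_nonneg_nonneg)
  also have "\<dots> = exp (\<Sum>i<m. e (i + n))"
    by (simp add: exp_sum add.commute)
  also have "(\<Sum>i<m. e (i + n)) \<le> (\<Sum>i. e (i + n))"
    using assms by (intro sum_le_suminf summable_ignore_initial_segment) auto
  also have "\<dots> \<le> suminf e"
    using suminf_split_initial_segment[OF assms(1), of n] sum_nonneg[of "{..<n}" e] assms(2) by simp
  finally show ?thesis by simp
qed

text \<open>The norms \<open>\<nu> n z\<close>, uniformly equivalent to the given one, are adapted to the maps: \<open>B n z\<close> is
  almost a contraction from \<open>\<nu> (Suc n) z\<close> to \<open>\<nu> n z\<close>. Hence all compositions are bounded by one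
  constant \<open>T\<close>. Appending one more factor changes \<open>B\<^sub>n \<cdots> B\<^sub>n\<^sub>+\<^sub>m\<^sub>-\<^sub>1 w\<close> by the image of
  \<open>B\<^sub>n\<^sub>+\<^sub>m w - w\<close>, that is by at most \<open>T e\<^sub>n\<^sub>+\<^sub>m\<close>, so the Weierstrass test applies. The limit
  differs from \<open>w\<close> by at most \<open>T\<close> times a tail of \<open>\<Sum>e\<close>. Using norms that vary with \<open>n\<close>
  covers diagonal factors with entries larger than 1, provided their products stay bounded.\<close>

lemma backward_products_converge:
  fixes B :: "nat \<Rightarrow> 'z \<Rightarrow> 'a::banach \<Rightarrow> 'a" and \<nu> :: "nat \<Rightarrow> 'z \<Rightarrow> 'a \<Rightarrow> real"
  assumes lin: "\<And>n z. z \<in> K \<Longrightarrow> bounded_linear (B n z)"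
    and norm_le: "\<And>n z v. z \<in> K \<Longrightarrow> norm v \<le> \<nu> n z v"
    and le_norm: "\<And>n z v. z \<in> K \<Longrightarrow> \<nu> n z v \<le> S * norm v"
    and step: "\<And>n z v. z \<in> K \<Longrightarrow> \<nu> n z (B n z v) \<le> (1 + e n) * \<nu> (Suc n) z v"
    and near: "\<And>n z. z \<in> K \<Longrightarrow> norm (B n z w - w) \<le> e n"
    and e: "summable e" and "S \<ge> 0"
  obtains y where
    "\<And>n. uniform_limit K (\<lambda>m z. backward (\<lambda>n. B n z) n m w) (y n) sequentially"
    "\<And>n z. z \<in> K \<Longrightarrow> y n z = B n z (y (Suc n) z)"
    "uniform_limit K y (\<lambda>_. w) sequentially"
proof (cases "K = {}")
  case True
  then show thesis by (intro that[of "\<lambda>_ _. w"]) auto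
next
  case False
  then obtain z0 where z0: "z0 \<in> K" by blast
  have e0: "0 \<le> e n" for n
    using order_trans[OF norm_ge_zero near[OF z0]] .
  define T where "T = exp (suminf e) * S"
  have T0: "T \<ge> 0" using \<open>S \<ge> 0\<close> by (simp add: T_def)
  have bound: "norm (backward (\<lambda>n. B n z) n m v) \<le> T * norm v" if z: "z \<in> K" for z n m v
  proof -
    have \<nu>0: "0 \<le> \<nu> k z u" for k u
      using order_trans[OF norm_ge_zero norm_le[OF z]] .
    have "\<nu> n z (backward (\<lambda>n. B n z) n m v) \<le> (\<Prod>i<m. 1 + e (n + i)) * \<nu> (n + m) z v"
    proof (induction m arbitrary: v)
      case (Suc m)
      have "\<nu> n z (backward (\<lambda>n. B n z) n (Suc m) v)
          \<le> (\<Prod>i<m. 1 + e (n + i)) * \<nu> (n + m) z (B (n + m) z v)"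
        unfolding backward_Suc_inner by (rule Suc.IH)
      also have "\<dots> \<le> (\<Prod>i<m. 1 + e (n + i)) * ((1 + e (n + m)) * \<nu> (Suc (n + m)) z v)"
        using e0 by (intro mult_left_mono step z prod_nonneg) (simp add: add_nonneg_nonneg)
      finally show ?case by (simp add: mult.assoc)
    qed simp
    also have "\<dots> \<le> exp (suminf e) * \<nu> (n + m) z v"
      by (intro mult_right_mono prod_one_plus_le_exp_suminf e e0 \<nu>0)
    also have "\<dots> \<le> exp (suminf e) * (S * norm v)"
      by (intro mult_left_mono le_norm z) simp
    finally show ?thesis using norm_le[OF z] order_trans unfolding T_def mult.assoc by blast
  qed
  \<comment> \<open>The change caused by appending the factor with index \<open>n + i\<close>.\<close>
  define d where "d n i z = backward (\<lambda>n. B n z) n i (B (n + i) z w - w)" for n i z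
  have d: "norm (d n i z) \<le> T * e (i + n)" if z: "z \<in> K" for n i z
    using order_trans[OF bound[OF z] mult_left_mono[OF near[OF z] T0]]
    by (simp add: d_def add.commute)
  have telescope: "backward (\<lambda>n. B n z) n m w = w + (\<Sum>i<m. d n i z)" if z: "z \<in> K" for n m z
  proof (induction m)
    case (Suc m)
    have "backward (\<lambda>n. B n z) n (Suc m) w = backward (\<lambda>n. B n z) n m w + d n m z"
      unfolding d_def backward_Suc_inner
      using backward_diff[of "\<lambda>n. B n z" n m "B (n + m) z w" w] lin[OF z]
      by (simp add: bounded_linear.linear)
    with Suc show ?case by simp
  qed simp
  have Te: "summable (\<lambda>i. T * e (i + n))" for n
    by (intro summable_mult summable_ignore_initial_segment e)
  define y where "y n z = w + (\<Sum>i. d n i z)" for n z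
  show thesis
  proof
    show lim: "uniform_limit K (\<lambda>m z. backward (\<lambda>n. B n z) n m w) (y n) sequentially" for n
    proof -
      have "uniform_limit K (\<lambda>m z. w + (\<Sum>i<m. d n i z)) (y n) sequentially"
        unfolding y_def
        by (intro uniform_limit_add uniform_limit_const Weierstrass_m_test[OF d Te])
      then show ?thesis
        by (rule uniform_limit_cong'[THEN iffD1, rotated -1]) (simp_all add: telescope)
    qed
    show "y n z = B n z (y (Suc n) z)" if z: "z \<in> K" for n z
    proof (rule LIMSEQ_unique)
      have "(\<lambda>m. backward (\<lambda>n. B n z) n m w) \<longlonglongrightarrow> y n z"
        using lim z by (rule tendsto_uniform_limitI)
      then show "(\<lambda>m. backward (\<lambda>n. B n z) n (Suc m) w) \<longlonglongrightarrow> y n z"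
        by (rule LIMSEQ_Suc)
      have "(\<lambda>m. backward (\<lambda>n. B n z) (Suc n) m w) \<longlonglongrightarrow> y (Suc n) z"
        using lim z by (rule tendsto_uniform_limitI)
      from bounded_linear.tendsto[OF lin[OF z] this]
      show "(\<lambda>m. backward (\<lambda>n. B n z) n (Suc m) w) \<longlonglongrightarrow> B n z (y (Suc n) z)"
        by simp
    qed
    show "uniform_limit K y (\<lambda>_. w) sequentially"
      unfolding uniform_limit_iff eventually_sequentially
    proof (intro allI impI)
      fix \<epsilon> :: real assume "\<epsilon> > 0"
      then obtain N where N: "\<And>n. n \<ge> N \<Longrightarrow> norm (\<Sum>i. T * e (i + n)) < \<epsilon>"
        using suminf_exist_split[OF _ summable_mult[OF e, of T]] by blast
      have "dist (y n z) w < \<epsilon>" if "n \<ge> N" "z \<in> K" for n z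
      proof -
        have "norm (\<Sum>i. d n i z) \<le> (\<Sum>i. T * e (i + n))"
          by (intro norm_suminf_le d Te that)
        with N[OF that(1)] show ?thesis by (simp add: y_def dist_norm)
      qed
      then show "\<exists>N. \<forall>n\<ge>N. \<forall>z\<in>K. dist (y n z) w < \<epsilon>" by blast
    qed
  qed
qed

text \<open>The recursion is \<open>x\<^sub>n\<^sub>+\<^sub>1 = (I + E\<^sub>n) diag(1, r\<^sub>n) x\<^sub>n\<close> with \<open>\<bar>r\<^sub>n\<bar> \<le> 1\<close>, so \<open>x\<^sub>n\<close> stays
  bounded by \<open>exp (\<Sum>e) \<le> 2\<close>. The first component changes by at most \<open>2 e\<^sub>n\<close> in each step: it
  converges uniformly, and its limit differs from 1 by at most \<open>1/2\<close> thanks to \<open>\<Sum>e \<le> 1/4\<close>.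
  The second component is multiplied by \<open>r\<^sub>n\<close> and receives an input of at most \<open>2 e\<^sub>n\<close>; inputs after
  a late index \<open>m\<close> are small in total, and what was there at \<open>m\<close> is wiped out by the product
  of the \<open>r\<^sub>j\<close>.\<close>

lemma dominant_component:
  fixes E :: "nat \<Rightarrow> 'z \<Rightarrow> complex^2 \<Rightarrow> complex^2" and x :: "nat \<Rightarrow> 'z \<Rightarrow> complex^2"
  assumes E: "\<And>n z v. z \<in> K \<Longrightarrow> norm (E n z v) \<le> e n * norm v"
    and r: "\<And>n z. z \<in> K \<Longrightarrow> norm (r n z) \<le> 1"
    and contract: "\<And>m \<epsilon>. \<epsilon> > 0 \<Longrightarrow> \<exists>n0. \<forall>n\<ge>n0. \<forall>z\<in>K. (\<Prod>j\<in>{m..<n}. norm (r j z)) < \<epsilon>"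
    and e: "summable e" "\<And>n. 0 \<le> e n" "suminf e \<le> 1/4"
    and x0: "\<And>z. z \<in> K \<Longrightarrow> x 0 z = axis 1 1"
    and xSuc: "\<And>n z. z \<in> K \<Longrightarrow>
          x (Suc n) z = diag2 1 (r n z) *v x n z + E n z (diag2 1 (r n z) *v x n z)"
  obtains g where "uniform_limit K x (\<lambda>z. axis 1 (g z)) sequentially"
    "\<And>z. z \<in> K \<Longrightarrow> norm (g z) \<ge> 1/2"
proof -
  have dx: "norm (diag2 1 (r n z) *v x n z) \<le> norm (x n z)" if "z \<in> K" for n z
    using norm_diag2_mult_vec_le[of 1 1 "r n z" "x n z"] r[OF that] by simp
  have x_le: "norm (x n z) \<le> 2" if z: "z \<in> K" for n z
  proof -
    have "norm (x n z) \<le> (\<Prod>i<n. 1 + e (0 + i))"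
    proof (induction n)
      case (Suc n)
      have "norm (x (Suc n) z) \<le> (1 + e n) * norm (diag2 1 (r n z) *v x n z)"
        unfolding xSuc[OF z] using E[OF z, of n "diag2 1 (r n z) *v x n z"]
        by (intro order_trans[OF norm_triangle_ineq]) (simp add: algebra_simps)
      also have "\<dots> \<le> (1 + e n) * (\<Prod>i<n. 1 + e (0 + i))"
        using dx[OF z] Suc e(2)[of n] by (intro mult_left_mono) (auto intro: order_trans)
      finally show ?case by (simp add: mult.commute)
    qed (simp add: x0[OF z])
    also have "\<dots> \<le> exp (suminf e)" by (rule prod_one_plus_le_exp_suminf[OF e(1,2)])
    also have "\<dots> \<le> exp (1/4)" using e(3) by simp
    also have "\<dots> \<le> 2" using exp_bound[of "1/4"] by (simp add: power2_eq_square)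
    finally show ?thesis .
  qed
  define d where "d n z = E n z (diag2 1 (r n z) *v x n z)" for n z
  have d: "norm (d n z $ i) \<le> 2 * e n" if z: "z \<in> K" for n z i
  proof -
    have "norm (d n z) \<le> e n * norm (diag2 1 (r n z) *v x n z)"
      unfolding d_def by (rule E[OF z])
    also have "\<dots> \<le> e n * 2"
      using dx[OF z] x_le[OF z] e(2) by (intro mult_left_mono) (auto intro: order_trans)
    finally show ?thesis using Finite_Cartesian_Product.norm_nth_le[where x="d n z" and i=i] by linarith
  qed
  have x1: "x (Suc n) z $ 1 = x n z $ 1 + d n z $ 1"
    and x2: "x (Suc n) z $ 2 = r n z * x n z $ 2 + d n z $ 2" if "z \<in> K" for n z
    by (simp_all add: xSuc[OF that] d_def diag2_mult_vec)
  have sum2e: "summable (\<lambda>n. 2 * e n)" by (intro summable_mult e)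
  define g where "g z = 1 + (\<Sum>n. d n z $ 1)" for z
  have x1_eq: "x n z $ 1 = 1 + (\<Sum>i<n. d i z $ 1)" if z: "z \<in> K" for n z
    by (induction n) (simp_all add: x0 x1 z)
  have "uniform_limit K (\<lambda>n z. 1 + (\<Sum>i<n. d i z $ 1)) g sequentially"
    unfolding g_def by (intro uniform_limit_add uniform_limit_const Weierstrass_m_test[OF d sum2e])
  then have lim1: "uniform_limit K (\<lambda>n z. x n z $ 1) g sequentially"
    by (rule uniform_limit_cong'[THEN iffD1, rotated -1]) (simp_all add: x1_eq)
  have x2_split: "norm (x (m + k) z $ 2) \<le> (\<Prod>j\<in>{m..<m + k}. norm (r j z)) * 2 + (\<Sum>i<k. 2 * e (i + m))"
    if z: "z \<in> K" for m k z
  proof (induction k)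
    case 0
    show ?case using x_le[OF z, of m] Finite_Cartesian_Product.norm_nth_le[where x="x m z" and i=2] by simp
  next
    case (Suc k)
    let ?S = "\<Sum>i<k. 2 * e (i + m)"
    have "norm (x (m + Suc k) z $ 2) \<le> norm (r (m + k) z) * norm (x (m + k) z $ 2) + 2 * e (k + m)"
      using d[OF z, of "m + k" 2] by (simp add: x2 z norm_mult[symmetric] add.commute[of k] norm_triangle_le)
    also have "norm (r (m + k) z) * norm (x (m + k) z $ 2)
        \<le> norm (r (m + k) z) * ((\<Prod>j\<in>{m..<m + k}. norm (r j z)) * 2 + ?S)"
      by (intro mult_left_mono Suc) auto
    also have "\<dots> \<le> (\<Prod>j\<in>{m..<m + Suc k}. norm (r j z)) * 2 + ?S"
      using mult_right_mono[OF r[OF z, of "m + k"], of ?S] e(2)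
      by (simp add: sum_nonneg algebra_simps)
    finally show ?case by simp
  qed
  have lim2: "uniform_limit K (\<lambda>n z. x n z $ 2) (\<lambda>_. 0) sequentially"
    unfolding uniform_limit_iff eventually_sequentially
  proof (intro allI impI)
    fix \<epsilon> :: real assume \<epsilon>: "\<epsilon> > 0"
    then obtain m where m: "norm (\<Sum>i. 2 * e (i + m)) < \<epsilon> / 2"
      using suminf_exist_split[OF _ sum2e, of "\<epsilon> / 2"] by auto
    obtain n0 where n0: "\<And>n z. n \<ge> n0 \<Longrightarrow> z \<in> K \<Longrightarrow> (\<Prod>j\<in>{m..<n}. norm (r j z)) < \<epsilon> / 4"
      using contract[of "\<epsilon> / 4" m] \<epsilon> by auto
    have "dist (x n z $ 2) 0 < \<epsilon>" if n: "n \<ge> max m n0" and z: "z \<in> K" for n z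
    proof -
      define k where "k = n - m"
      then have nk: "n = m + k" using n by simp
      have "(\<Sum>i<k. 2 * e (i + m)) \<le> (\<Sum>i. 2 * e (i + m))"
        using e(2) summable_ignore_initial_segment[OF sum2e, of m] by (intro sum_le_suminf) auto
      then show ?thesis
        using x2_split[OF z, of m k] n0[of n z] n z m unfolding nk by (simp add: abs_less_iff)
    qed
    then show "\<exists>N. \<forall>n\<ge>N. \<forall>z\<in>K. dist (x n z $ 2) 0 < \<epsilon>" by blast
  qed
  show thesis
  proof
    show "uniform_limit K x (\<lambda>z. axis 1 (g z)) sequentially"
      unfolding uniform_limit_iff
    proof (intro allI impI)
      fix \<epsilon> :: real assume "\<epsilon> > 0"
      then have "\<forall>\<^sub>F n in sequentially. \<forall>z\<in>K. dist (x n z $ 1) (g z) < \<epsilon> / 2"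
        "\<forall>\<^sub>F n in sequentially. \<forall>z\<in>K. dist (x n z $ 2) 0 < \<epsilon> / 2"
        using lim1 lim2 half_gt_zero unfolding uniform_limit_iff by blast+
      then show "\<forall>\<^sub>F n in sequentially. \<forall>z\<in>K. dist (x n z) (axis 1 (g z)) < \<epsilon>"
      proof eventually_elim
        case (elim n)
        show ?case
        proof
          fix z assume "z \<in> K"
          then show "dist (x n z) (axis 1 (g z)) < \<epsilon>"
            using elim norm_le_sum_components[of "x n z - axis 1 (g z)"]
            by (fastforce simp: dist_norm axis_def)
        qed
      qed
    qed
    show "norm (g z) \<ge> 1/2" if z: "z \<in> K" for z
    proof -
      have "norm (\<Sum>n. d n z $ 1) \<le> (\<Sum>n. 2 * e n)"
        by (intro norm_suminf_le d z sum2e)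
      also have "\<dots> \<le> 1/2" using e(3) by (simp add: suminf_mult[OF e(1)])
      finally show ?thesis
        using norm_triangle_ineq2[of 1 "- (\<Sum>n. d n z $ 1)"] by (simp add: g_def)
    qed
  qed
qed

section \<open>Normalised solutions\<close>

text \<open>The transition matrix \<open>C\<^sub>n\<^sup>-\<^sup>1 C\<^sub>n\<^sub>+\<^sub>1\<close> is a perturbation of the identity that is controlled
  by the increment of \<open>C\<^sub>n\<close>.\<close>

lemma matrix_inv_mult_eq:
  fixes A A' :: "complex^'n^'n"
  assumes "invertible A"
  shows "matrix_inv A *v (A' *v v) = v + matrix_inv A *v ((A' - A) *v v)"
proof -
  have "matrix_inv A *v (A' *v v) = matrix_inv A *v (A *v v + (A' - A) *v v)"
    by (simp add: matrix_vector_mult_diff_rdistrib)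
  then show ?thesis
    by (simp only: matrix_vector_right_distrib matrix_inv_cancel[OF assms])
qed

text \<open>The data of the theorem reindexed by the natural numbers, with the hypotheses on convergence
  reduced to two estimates: a common bound \<open>\<kappa>\<close> for the inverses of the \<open>c n z\<close>, and summable bounds
  \<open>d n\<close> for the increments.\<close>

locale diagonalised_system =
  fixes K :: "complex set" and c :: "nat \<Rightarrow> complex \<Rightarrow> complex^2^2"
    and lp lm :: "nat \<Rightarrow> complex \<Rightarrow> complex" and \<kappa> :: real and d :: "nat \<Rightarrow> real"
  assumes K: "K \<noteq> {}"
    and hol_c: "hol_cont_mat K (c n)" and hol_lp: "hol_cont K (lp n)" and hol_lm: "hol_cont K (lm n)"
    and inv_c: "z \<in> K \<Longrightarrow> invertible (c n z)"
    and inv_le: "z \<in> K \<Longrightarrow> norm (matrix_inv (c n z)) \<le> \<kappa>"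
    and diff_le: "z \<in> K \<Longrightarrow> norm (c (Suc n) z - c n z) \<le> d n" and summable_d: "summable d"
    and lm_nz: "z \<in> K \<Longrightarrow> lm n z \<noteq> 0" and lm_le: "z \<in> K \<Longrightarrow> norm (lm n z) \<le> norm (lp n z)"
begin

lemma lp_nz: "z \<in> K \<Longrightarrow> lp n z \<noteq> 0"
  using lm_nz[of z n] lm_le[of z n] by auto

lemma d_nonneg: "0 \<le> d n"
  using K diff_le norm_ge_zero order_trans by blast

lemma \<kappa>_nonneg: "0 \<le> \<kappa>"
  using K inv_le norm_ge_zero order_trans by blast

lemma transition_error:
  assumes z: "z \<in> K"
  shows "norm (matrix_inv (c n z) *v ((c (Suc n) z - c n z) *v v)) \<le> \<kappa> * d n * norm v"
    and "norm (matrix_inv (c (Suc n) z) *v ((c n z - c (Suc n) z) *v v)) \<le> \<kappa> * d n * norm v"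
proof -
  have *: "norm (A *v (B *v v)) \<le> \<kappa> * d n * norm v"
    if "norm A \<le> \<kappa>" "norm B \<le> d n" for A B :: "complex^2^2"
  proof -
    have "norm (A *v (B *v v)) \<le> norm A * norm (B *v v)" by (rule norm_matrix_vector_mult_le)
    also have "\<dots> \<le> norm A * (norm B * norm v)"
      by (intro mult_left_mono norm_matrix_vector_mult_le) simp
    also have "\<dots> \<le> \<kappa> * (d n * norm v)"
      using that \<kappa>_nonneg d_nonneg by (intro mult_mono) auto
    finally show ?thesis by (simp add: mult.assoc)
  qed
  show "norm (matrix_inv (c n z) *v ((c (Suc n) z - c n z) *v v)) \<le> \<kappa> * d n * norm v"
    by (intro * inv_le diff_le z)
  show "norm (matrix_inv (c (Suc n) z) *v ((c n z - c (Suc n) z) *v v)) \<le> \<kappa> * d n * norm v"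
    using diff_le[OF z, of n] by (intro * inv_le z) (simp add: norm_minus_commute)
qed

text \<open>If \<open>y\<close> satisfies the second condition, then \<open>(\<Prod>j<n. l j z) *s (c n z *v y n z)\<close> solves the
  system with matrices \<open>c n z ** diag2 (lp n z) (lm n z) ** matrix_inv (c n z)\<close>; this is the original
  equation for a solution that has been divided by the product of the \<open>l\<close> and expressed in the
  eigenbasis.\<close>

definition normalised_solution ::
    "(nat \<Rightarrow> complex \<Rightarrow> complex) \<Rightarrow> (nat \<Rightarrow> complex \<Rightarrow> complex^2) \<Rightarrow> 2 \<Rightarrow> bool" where
  "normalised_solution l y i \<longleftrightarrow>
     (\<forall>n. hol_cont_vec K (y n)) \<and>
     (\<forall>n. \<forall>z\<in>K. l n z *s (c (Suc n) z *v y (Suc n) z) =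
                    c n z *v (diag2 (lp n z) (lm n z) *v y n z)) \<and>
     uniform_limit K y (\<lambda>_. axis i 1) sequentially"

text \<open>With \<open>G = diag(l/\<lambda>\<^sup>+, l/\<lambda>\<^sup>-)\<close> this is the map that recovers \<open>y n z\<close> from \<open>y (Suc n) z\<close>
  for a normalised solution.\<close>

definition pull_back :: "(complex \<Rightarrow> complex^2^2) \<Rightarrow> nat \<Rightarrow> complex \<Rightarrow> complex^2 \<Rightarrow> complex^2" where
  "pull_back G n z v = G z *v (matrix_inv (c n z) *v (c (Suc n) z *v v))"

lemma hol_cont_vec_backward:
  assumes G: "\<And>n. hol_cont_mat K (G n)"
  shows "hol_cont_vec K (\<lambda>z. backward (\<lambda>n. pull_back (G n) n z) n m w)"
proof (induction m arbitrary: n)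
  case (Suc m)
  then show ?case
    unfolding backward.simps pull_back_def
    by (intro hol_cont_vec_mult hol_cont_mat_inv G hol_c inv_c)
qed simp

text \<open>Here \<open>diag(a, b) = diag(l/\<lambda>\<^sup>+, l/\<lambda>\<^sup>-)\<close>, by the last assumption. The weights \<open>p\<close> and \<open>q\<close> absorb
  the growth of the products of \<open>a\<close> and of \<open>b\<close>: with \<open>\<nu>\<^sub>n v = p\<^sub>n \<bar>v\<^sub>1\<bar> + q\<^sub>n \<bar>v\<^sub>2\<bar>\<close> the
  diagonal factor does not increase the norm when passing from \<open>\<nu>\<^sub>n\<^sub>+\<^sub>1\<close> to \<open>\<nu>\<^sub>n\<close>, so only the
  summable error of the transition matrix is left, and the convergence of backward products
  yields the solution.\<close>

lemma normalised_solution_if_weights: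
  fixes a b :: "nat \<Rightarrow> complex \<Rightarrow> complex" and p q :: "nat \<Rightarrow> complex \<Rightarrow> real"
  assumes hol: "\<And>n. hol_cont K (a n)" "\<And>n. hol_cont K (b n)"
    and ab: "\<And>n z. z \<in> K \<Longrightarrow> norm (a n z) \<le> S" "\<And>n z. z \<in> K \<Longrightarrow> norm (b n z) \<le> S"
    and p: "\<And>n z. z \<in> K \<Longrightarrow> 1 \<le> p n z" "\<And>n z. z \<in> K \<Longrightarrow> p n z \<le> S"
      "\<And>n z. z \<in> K \<Longrightarrow> p n z * norm (a n z) \<le> p (Suc n) z"
    and q: "\<And>n z. z \<in> K \<Longrightarrow> 1 \<le> q n z" "\<And>n z. z \<in> K \<Longrightarrow> q n z \<le> S"
      "\<And>n z. z \<in> K \<Longrightarrow> q n z * norm (b n z) \<le> q (Suc n) z"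
    and eigen: "\<And>n z. z \<in> K \<Longrightarrow> diag2 (a n z) (b n z) *v axis i 1 = axis i 1"
    and rel: "\<And>n z v. z \<in> K \<Longrightarrow>
          diag2 (lp n z) (lm n z) *v (diag2 (a n z) (b n z) *v v) = l n z *s v"
  shows "\<exists>y. normalised_solution l y i"
proof -
  define G where "G n z = diag2 (a n z) (b n z)" for n z
  define B where "B n z = pull_back (G n) n z" for n z
  define \<nu> where "\<nu> n z v = p n z * norm (v $ 1) + q n z * norm (v $ 2)"
    for n z and v :: "complex^2"
  define e where "e n = 2 * S * (\<kappa> * d n)" for n
  obtain z0 where z0: "z0 \<in> K" using K by blast
  have S: "S \<ge> 1" using order_trans[OF p(1,2)[OF z0]] .
  have \<kappa>d: "0 \<le> \<kappa> * d n" for n by (simp add: d_nonneg \<kappa>_nonneg)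
  have B_eq: "B n z v = G n z *v (v + matrix_inv (c n z) *v ((c (Suc n) z - c n z) *v v))"
    if "z \<in> K" for n z v
    unfolding B_def pull_back_def by (subst matrix_inv_mult_eq[OF inv_c[OF that]]) (rule refl)
  have pS: "p n z \<in> {0..S}" "q n z \<in> {0..S}" if "z \<in> K" for n z
    using p(1,2)[OF that, of n] q(1,2)[OF that, of n] by auto
  have \<nu>_le: "\<nu> n z v \<le> 2 * S * norm v" if z: "z \<in> K" for n z v
  proof -
    have "\<nu> n z v \<le> S * norm v + S * norm v"
      unfolding \<nu>_def using pS[OF z] S
      by (intro add_mono mult_mono Finite_Cartesian_Product.norm_nth_le) auto
    then show ?thesis by simp
  qed
  have le_\<nu>: "norm v \<le> \<nu> n z v" if z: "z \<in> K" for n z v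
  proof -
    have "norm v \<le> 1 * norm (v $ 1) + 1 * norm (v $ 2)"
      using norm_le_sum_components[of v] by simp
    also have "\<dots> \<le> \<nu> n z v"
      unfolding \<nu>_def by (intro add_mono mult_right_mono p(1) q(1) z) auto
    finally show ?thesis .
  qed
  have \<nu>_add: "\<nu> n z (u + v) \<le> \<nu> n z u + \<nu> n z v" if z: "z \<in> K" for n z u v
  proof -
    have "\<nu> n z (u + v) \<le> p n z * (norm (u $ 1) + norm (v $ 1)) + q n z * (norm (u $ 2) + norm (v $ 2))"
      unfolding \<nu>_def using pS[OF z, of n]
      by (intro add_mono mult_left_mono) (auto intro: norm_triangle_ineq)
    then show ?thesis by (simp add: \<nu>_def algebra_simps)
  qed
  have \<nu>_G: "\<nu> n z (G n z *v v) \<le> \<nu> (Suc n) z v" if z: "z \<in> K" for n z v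
    using mult_right_mono[OF p(3)[OF z, of n], of "norm (v $ 1)"]
      mult_right_mono[OF q(3)[OF z, of n], of "norm (v $ 2)"]
    by (simp add: \<nu>_def G_def diag2_mult_vec norm_mult mult.assoc)
  have hol_G: "hol_cont_mat K (G n)" for n
    unfolding G_def by (intro hol_cont_mat_diag2 hol)
  obtain y where y:
    "\<And>n. uniform_limit K (\<lambda>m z. backward (\<lambda>n. B n z) n m (axis i 1)) (y n) sequentially"
    "\<And>n z. z \<in> K \<Longrightarrow> y n z = B n z (y (Suc n) z)"
    "uniform_limit K y (\<lambda>_. axis i 1) sequentially"
  proof (rule backward_products_converge[of K B \<nu> "2 * S" e "axis i 1"])
    show "bounded_linear (B n z)" for n z
      unfolding B_def pull_back_def
      by (intro bounded_linear_compose[OF bounded_linear_matrix_vector_mult]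
          bounded_linear_matrix_vector_mult)
    show "norm v \<le> \<nu> n z v" if "z \<in> K" for n z v using le_\<nu>[OF that] .
    show "\<nu> n z v \<le> 2 * S * norm v" if "z \<in> K" for n z v using \<nu>_le[OF that] .
    show "\<nu> n z (B n z v) \<le> (1 + e n) * \<nu> (Suc n) z v" if z: "z \<in> K" for n z v
    proof -
      let ?E = "matrix_inv (c n z) *v ((c (Suc n) z - c n z) *v v)"
      have "\<nu> n z (B n z v) \<le> \<nu> (Suc n) z (v + ?E)"
        unfolding B_eq[OF z] by (rule \<nu>_G[OF z])
      also have "\<dots> \<le> \<nu> (Suc n) z v + \<nu> (Suc n) z ?E"
        by (rule \<nu>_add[OF z])
      also have "\<nu> (Suc n) z ?E \<le> 2 * S * (\<kappa> * d n * norm v)"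
        using S by (intro order_trans[OF \<nu>_le[OF z]] mult_left_mono transition_error z) auto
      also have "\<dots> \<le> e n * \<nu> (Suc n) z v"
        unfolding e_def mult.assoc[of "2 * S"]
        using S \<kappa>d le_\<nu>[OF z] by (intro mult_left_mono) auto
      finally show ?thesis by (simp add: algebra_simps)
    qed
    show "norm (B n z (axis i 1) - axis i 1) \<le> e n" if z: "z \<in> K" for n z
    proof -
      let ?E = "matrix_inv (c n z) *v ((c (Suc n) z - c n z) *v axis i 1)"
      have "B n z (axis i 1) - axis i 1 = G n z *v ?E"
        unfolding B_eq[OF z] matrix_vector_right_distrib G_def eigen[OF z] by simp
      also have "norm \<dots> \<le> S * norm ?E"
        unfolding G_def by (intro norm_diag2_mult_vec_le ab z)
      also have "\<dots> \<le> S * (\<kappa> * d n)"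
        using transition_error(1)[OF z, of n "axis i 1"] S by (intro mult_left_mono) auto
      also have "\<dots> \<le> e n"
        unfolding e_def using S \<kappa>d by (intro mult_right_mono) auto
      finally show ?thesis .
    qed
    show "summable e" unfolding e_def by (intro summable_mult summable_d)
  qed (use S in auto)
  have "normalised_solution l y i"
    unfolding normalised_solution_def
  proof (intro conjI allI ballI y(3))
    show "hol_cont_vec K (y n)" for n
      using hol_cont_vec_backward[OF hol_G] by (intro hol_cont_vec_uniform_limit[OF _ y(1)]) (simp add: B_def)
    show "l n z *s (c (Suc n) z *v y (Suc n) z) = c n z *v (diag2 (lp n z) (lm n z) *v y n z)"
      if z: "z \<in> K" for n z
      unfolding y(2)[OF z, of n] B_def pull_back_def G_def rel[OF z]
      by (simp add: vec.scale matrix_inv_cancel[OF inv_c[OF z]])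
  qed
  then show ?thesis by blast
qed

lemma diag2_axis: "diag2 1 b *v axis 1 1 = axis 1 1" "diag2 a 1 *v axis 2 1 = axis 2 1"
  by (simp_all add: diag2_mult_vec vec_eq_iff forall_2 axis_def)

text \<open>Both diagonal entries \<open>\<lambda>\<^sup>-/\<lambda>\<^sup>+\<close> and \<open>1\<close> have modulus at most 1, so constant weights do.\<close>

lemma recessive_solution: "\<exists>y. normalised_solution lm y 2"
proof (rule normalised_solution_if_weights[where a = "\<lambda>n z. lm n z / lp n z" and b = "\<lambda>_ _. 1"
      and p = "\<lambda>_ _. 1" and q = "\<lambda>_ _. 1" and S = 1])
  show "hol_cont K (\<lambda>z. lm n z / lp n z)" for n
    by (intro hol_cont_divide hol_lp hol_lm lp_nz)
  show "norm (lm n z / lp n z) \<le> 1" "1 * norm (lm n z / lp n z) \<le> 1" if "z \<in> K" for n z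
    using lm_le[OF that, of n] lp_nz[OF that, of n] by (simp_all add: norm_divide)
  show "diag2 (lp n z) (lm n z) *v (diag2 (lm n z / lp n z) 1 *v v) = lm n z *s v"
    if "z \<in> K" for n z v
    using lp_nz[OF that, of n] by (simp add: diag2_mult_vec vec_eq_iff forall_2)
qed (simp_all add: diag2_axis)

text \<open>The second diagonal entry \<open>\<lambda>\<^sup>+/\<lambda>\<^sup>-\<close> has modulus at least 1; its partial products serve as
  the weight \<open>q\<close>, which makes the third condition on \<open>q\<close> an equality.\<close>

lemma dominant_solution_if_bounded:
  assumes bounded: "\<And>n z. z \<in> K \<Longrightarrow> (\<Prod>j<n. norm (lp j z / lm j z)) \<le> S"
  shows "\<exists>y. normalised_solution lp y 1"
proof (rule normalised_solution_if_weights[where a = "\<lambda>_ _. 1" and b = "\<lambda>n z. lp n z / lm n z"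
      and p = "\<lambda>_ _. 1" and q = "\<lambda>n z. \<Prod>j<n. norm (lp j z / lm j z)" and S = S])
  have ge1: "1 \<le> norm (lp n z / lm n z)" if "z \<in> K" for n z
    using lm_le[OF that, of n] lm_nz[OF that, of n] by (simp add: norm_divide)
  show prod_ge1: "1 \<le> (\<Prod>j<n. norm (lp j z / lm j z))" if "z \<in> K" for n z
    using ge1[OF that] by (intro prod_ge_1) auto
  show "(1::real) \<le> S" if "z \<in> K" for z :: complex
    using bounded[OF that, of 0] by simp
  then show "norm (1::complex) \<le> S" if "z \<in> K" for z :: complex
    using that by simp
  show "hol_cont K (\<lambda>z. lp n z / lm n z)" for n
    by (intro hol_cont_divide hol_lp hol_lm lm_nz)
  show "norm (lp n z / lm n z) \<le> S" if z: "z \<in> K" for n z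
    using mult_right_mono[OF prod_ge1[OF z, of n], of "norm (lp n z / lm n z)"] bounded[OF z, of "Suc n"]
    by (simp add: mult.commute)
  show "diag2 (lp n z) (lm n z) *v (diag2 1 (lp n z / lm n z) *v v) = lp n z *s v"
    if "z \<in> K" for n z v
    using lm_nz[OF that, of n] by (simp add: diag2_mult_vec vec_eq_iff forall_2)
  show "(\<Prod>j<n. norm (lp j z / lm j z)) * norm (lp n z / lm n z) \<le> (\<Prod>j<Suc n. norm (lp j z / lm j z))"
    for n z
    by (simp only: prod.lessThan_Suc mult.commute order_refl)
  show "(\<Prod>j<n. norm (lp j z / lm j z)) \<le> S" if "z \<in> K" for n z
    by (rule bounded[OF that])
qed (simp_all add: diag2_axis)

text \<open>The solution with value \<open>e\<^sub>1\<close> at \<open>N\<close> is obtained by running the inverse steps from \<open>N\<close> down to \<open>0\<close>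
  and the forward steps \<open>A\<close> from there on. This defines it at all indices by one recursion, whose
  holomorphic dependence on \<open>z\<close> is immediate. Dividing by the limit \<open>g\<close> of its first component, a
  function without zeros on \<open>K\<close>, normalises it.\<close>

lemma dominant_solution_if_unbounded:
  assumes contract: "\<And>m \<epsilon>. \<epsilon> > 0 \<Longrightarrow>
    \<exists>n0. \<forall>n\<ge>n0. \<forall>z\<in>K. (\<Prod>j\<in>{m..<n}. norm (lm j z / lp j z)) < \<epsilon>"
  shows "\<exists>y. normalised_solution lp y 1"
proof -
  define e where "e n = \<kappa> * d n" for n
  have e: "summable e" "\<And>n. 0 \<le> e n"
    unfolding e_def by (simp_all add: summable_mult summable_d \<kappa>_nonneg d_nonneg)
  obtain N where "norm (\<Sum>n. e (n + N)) < 1/4"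
    using suminf_exist_split[OF _ e(1), of "1/4"] by auto
  then have N: "(\<Sum>n. e (n + N)) \<le> 1/4" by simp
  define r where "r n z = lm n z / lp n z" for n z
  have r: "norm (r n z) \<le> 1" if "z \<in> K" for n z
    using lm_le[OF that, of n] lp_nz[OF that, of n] by (simp add: r_def norm_divide)
  define G where "G n z = diag2 1 (lp n z / lm n z)" for n z
  \<comment> \<open>One step of the recursion for \<open>y\<close>, and the inverse of \<open>pull_back (G n) n z\<close>.\<close>
  define A where "A n z v = matrix_inv (c (Suc n) z) *v (c n z *v (diag2 1 (r n z) *v v))" for n z v
  have A_pull_back: "A n z (pull_back (G n) n z v) = v" if z: "z \<in> K" for n z v
  proof -
    have "diag2 1 (r n z) *v (G n z *v u) = u" for u
      using lm_nz[OF z, of n] lp_nz[OF z, of n]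
      by (simp add: r_def G_def diag2_mult_vec vec_eq_iff forall_2)
    then show ?thesis
      by (simp add: A_def pull_back_def matrix_inv_cancel[OF inv_c[OF z]])
  qed
  define x where "x n z = rec_nat (backward (\<lambda>n. pull_back (G n) n z) 0 N (axis 1 1)) (\<lambda>n. A n z) n"
    for n z
  have x_Suc: "x (Suc n) z = A n z (x n z)" for n z
    by (simp add: x_def)
  have hol_x: "hol_cont_vec K (x n)" for n
  proof (induction n)
    case 0
    have "hol_cont_mat K (G n)" for n
      unfolding G_def by (intro hol_cont_mat_diag2 hol_cont_divide hol_lp hol_lm lm_nz hol_cont_const)
    from hol_cont_vec_backward[OF this] show ?case by (simp add: x_def)
  next
    case (Suc n)
    have "hol_cont_vec K (\<lambda>z. A n z (x n z))"
      unfolding A_def r_def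
      by (intro hol_cont_vec_mult hol_cont_mat_inv hol_c inv_c hol_cont_mat_diag2 hol_cont_divide
          hol_lp hol_lm lp_nz hol_cont_const Suc)
    then show ?case by (simp add: x_Suc[abs_def])
  qed
  have x_N: "x N z = axis 1 1" if z: "z \<in> K" for z
  proof -
    have "x j z = backward (\<lambda>n. pull_back (G n) n z) j (N - j) (axis 1 1)" if "j \<le> N" for j
      using that
    proof (induction j)
      case (Suc j)
      then have "N - j = Suc (N - Suc j)" by simp
      with Suc show ?case by (simp add: x_Suc A_pull_back[OF z])
    qed (simp add: x_def)
    then show ?thesis by simp
  qed
  obtain g where lim: "uniform_limit K (\<lambda>n. x (n + N)) (\<lambda>z. axis 1 (g z)) sequentially"
    and g: "\<And>z. z \<in> K \<Longrightarrow> norm (g z) \<ge> 1/2"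
  proof (rule dominant_component[where x = "\<lambda>n. x (n + N)" and K = K and r = "\<lambda>n. r (n + N)"
        and e = "\<lambda>n. e (n + N)"
        and E = "\<lambda>n z v. matrix_inv (c (Suc (n + N)) z) *v ((c (n + N) z - c (Suc (n + N)) z) *v v)"])
    show "norm (matrix_inv (c (Suc (n + N)) z) *v ((c (n + N) z - c (Suc (n + N)) z) *v v)) \<le> e (n + N) * norm v"
      if "z \<in> K" for n z v
      unfolding e_def by (rule transition_error(2)[OF that])
    show "\<exists>n0. \<forall>n\<ge>n0. \<forall>z\<in>K. (\<Prod>j\<in>{m..<n}. norm (r (j + N) z)) < \<epsilon>" if \<epsilon>: "\<epsilon> > 0" for m \<epsilon>
    proof -
      obtain n0 where n0: "\<And>n z. n \<ge> n0 \<Longrightarrow> z \<in> K \<Longrightarrow> (\<Prod>j\<in>{m + N..<n}. norm (r j z)) < \<epsilon>"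
        using contract[OF \<epsilon>, of "m + N"] unfolding r_def by blast
      have "(\<Prod>j\<in>{m..<n}. norm (r (j + N) z)) < \<epsilon>" if "n \<ge> n0" "z \<in> K" for n z
        using n0[of "n + N" z] that by (simp add: prod.shift_bounds_nat_ivl)
      then show ?thesis by blast
    qed
    show "x (Suc n + N) z = diag2 1 (r (n + N) z) *v x (n + N) z +
        matrix_inv (c (Suc (n + N)) z) *v ((c (n + N) z - c (Suc (n + N)) z) *v (diag2 1 (r (n + N) z) *v x (n + N) z))"
      if "z \<in> K" for n z
      unfolding add_Suc x_Suc A_def by (rule matrix_inv_mult_eq[OF inv_c[OF that]])
    show "summable (\<lambda>n. e (n + N))" by (rule summable_ignore_initial_segment[OF e(1)])
  qed (use N e(2) x_N r that in auto)
  have g_nz: "g z \<noteq> 0" if "z \<in> K" for z using g[OF that] by auto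
  have "uniform_limit K (\<lambda>n z. x (n + N) z $ 1) (\<lambda>z. axis 1 (g z) $ (1::2)) sequentially"
    by (rule bounded_linear.uniform_limit[OF bounded_linear_vec_nth lim])
  moreover have "hol_cont K (\<lambda>z. x (n + N) z $ 1)" for n
    using hol_x unfolding hol_cont_vec_def by blast
  ultimately have hol_g: "hol_cont K g"
    using hol_cont_uniform_limit[where f = "\<lambda>n z. x (n + N) z $ 1" and g = g] by (simp add: axis_def)
  define y where "y n z = (1 / g z) *s x n z" for n z
  have "normalised_solution lp y 1"
    unfolding normalised_solution_def
  proof (intro conjI allI ballI)
    show "hol_cont_vec K (y n)" for n
      unfolding y_def by (intro hol_cont_vec_scale hol_cont_divide hol_g g_nz hol_x hol_cont_const)
    show "lp n z *s (c (Suc n) z *v y (Suc n) z) = c n z *v (diag2 (lp n z) (lm n z) *v y n z)"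
      if z: "z \<in> K" for n z
    proof -
      have "lp n z *s (c (Suc n) z *v x (Suc n) z) = c n z *v (lp n z *s (diag2 1 (r n z) *v x n z))"
        by (simp add: x_Suc A_def matrix_inv_cancel[OF inv_c[OF z]] vec.scale)
      also have "lp n z *s (diag2 1 (r n z) *v x n z) = diag2 (lp n z) (lm n z) *v x n z"
        using lp_nz[OF z, of n] by (simp add: r_def diag2_mult_vec vec_eq_iff forall_2)
      finally show ?thesis
        unfolding y_def vec.scale by (metis vector_smult_assoc mult.commute)
    qed
    show "uniform_limit K y (\<lambda>_. axis 1 1) sequentially"
      unfolding uniform_limit_iff
    proof (intro allI impI)
      fix \<epsilon> :: real assume "\<epsilon> > 0"
      then have "\<forall>\<^sub>F n in sequentially. \<forall>z\<in>K. dist (x (n + N) z) (axis 1 (g z)) < \<epsilon> / 2"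
        using lim half_gt_zero unfolding uniform_limit_iff by blast
      then have "\<forall>\<^sub>F n in sequentially. \<forall>z\<in>K. dist (y (n + N) z) (axis 1 1) < \<epsilon>"
      proof eventually_elim
        case (elim n)
        show ?case
        proof
          fix z assume z: "z \<in> K"
          have "y (n + N) z - axis 1 1 = (1 / g z) *s (x (n + N) z - axis 1 (g z))"
            using g_nz[OF z] by (simp add: y_def vec_eq_iff axis_def algebra_simps)
          moreover have "norm ((1 / g z) *s v) = norm v / norm (g z)" for v :: "complex^2"
            by (simp add: norm_vector_smult_complex norm_divide)
          moreover have "norm v / norm (g z) \<le> 2 * norm v" for v :: "complex^2"
            using g[OF z] g_nz[OF z] mult_right_mono[OF g[OF z], of "norm v"] by (simp add: divide_simps mult_ac)
          ultimately have "dist (y (n + N) z) (axis 1 1) \<le> 2 * dist (x (n + N) z) (axis 1 (g z))"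
            unfolding dist_norm by (simp del: vector_sub_rdistrib vector_ssub_ldistrib)
          with elim z show "dist (y (n + N) z) (axis 1 1) < \<epsilon>" by fastforce
        qed
      qed
      then show "\<forall>\<^sub>F n in sequentially. \<forall>z\<in>K. dist (y n z) (axis 1 1) < \<epsilon>"
        by (rule eventually_sequentially_seg[THEN iffD1])
    qed
  qed
  then show ?thesis by blast
qed

text \<open>In a vanishing combination the first components give
  \<open>\<bar>b\<bar> \<bar>\<Prod>\<lambda>\<^sup>+\<bar> \<bar>y\<^sup>+\<^sub>n\<^sub>,\<^sub>1\<bar> = \<bar>a\<bar> \<bar>\<Prod>\<lambda>\<^sup>-\<bar> \<bar>y\<^sup>-\<^sub>n\<^sub>,\<^sub>1\<bar>\<close>. Since \<open>\<bar>\<lambda>\<^sup>-\<bar> \<le> \<bar>\<lambda>\<^sup>+\<bar>\<close>, it follows that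
  \<open>\<bar>b\<bar> \<bar>y\<^sup>+\<^sub>n\<^sub>,\<^sub>1\<bar> \<le> \<bar>a\<bar> \<bar>y\<^sup>-\<^sub>n\<^sub>,\<^sub>1\<bar>\<close>, where the left side tends to \<open>\<bar>b\<bar>\<close> and the right side to 0; so
  \<open>b = 0\<close>. Then \<open>a = 0\<close> since
  \<open>y\<^sup>-\<close> tends to \<open>e\<^sub>2 \<noteq> 0\<close>.\<close>

lemma normalised_solutions_independent:
  assumes ym: "normalised_solution lm ym 2" and yp: "normalised_solution lp yp 1" and z: "z \<in> K"
    and zero: "\<And>n. a *s ((\<Prod>j<n. lm j z) *s (c n z *v ym n z)) + b *s ((\<Prod>j<n. lp j z) *s (c n z *v yp n z)) = 0"
  shows "a = 0 \<and> b = 0"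
proof -
  let ?m = "\<lambda>n. \<Prod>j<n. lm j z" and ?p = "\<lambda>n. \<Prod>j<n. lp j z"
  have "(\<lambda>n. ym n z) \<longlonglongrightarrow> axis 2 1" "(\<lambda>n. yp n z) \<longlonglongrightarrow> axis 1 1"
    using tendsto_uniform_limitI[OF _ z, of ym] tendsto_uniform_limitI[OF _ z, of yp] ym yp
    unfolding normalised_solution_def by blast+
  then have ym_lim: "(\<lambda>n. ym n z $ i) \<longlonglongrightarrow> axis 2 1 $ i" and yp_lim: "(\<lambda>n. yp n z $ i) \<longlonglongrightarrow> axis 1 1 $ i" for i
    by (auto intro: tendsto_vec_nth)
  have comb: "(a * ?m n) * ym n z $ i + (b * ?p n) * yp n z $ i = 0" for n i
  proof -
    have "c n z *v ((a * ?m n) *s ym n z + (b * ?p n) *s yp n z) = 0"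
      using zero[of n] by (simp add: matrix_vector_right_distrib vec.scale)
    then have "(a * ?m n) *s ym n z + (b * ?p n) *s yp n z = 0"
      by (metis matrix_inv_cancel(1)[OF inv_c[OF z]] matrix_vector_mult_0_right)
    then show ?thesis by (simp add: vec_eq_iff)
  qed
  have mnz: "?m n \<noteq> 0" for n using lm_nz[OF z] by simp
  have pnz: "?p n \<noteq> 0" for n using lp_nz[OF z] by simp
  have "norm (b * yp n z $ 1) \<le> norm (a * ym n z $ 1)" for n
  proof -
    have "norm (?p n) * norm (b * yp n z $ 1) = norm (?m n) * norm (a * ym n z $ 1)"
      using comb[of n 1] by (simp add: norm_mult[symmetric] add_eq_0_iff mult_ac)
    also have "\<dots> \<le> norm (?p n) * norm (a * ym n z $ 1)"
      by (intro mult_right_mono) (auto simp: prod_norm[symmetric] intro!: prod_mono lm_le z)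
    finally show ?thesis using pnz[of n] by simp
  qed
  then have "norm (b * axis 1 1 $ (1::2)) \<le> norm (a * axis 2 1 $ (1::2))"
    using LIMSEQ_le[OF tendsto_norm[OF tendsto_mult[OF tendsto_const[of b] yp_lim[of 1]]]
        tendsto_norm[OF tendsto_mult[OF tendsto_const[of a] ym_lim[of 1]]]] by blast
  then have b: "b = 0" by (simp add: axis_def)
  then have "a * ym n z $ 2 = 0" for n
    using comb[of n 2] mnz[of n] by auto
  then have "(\<lambda>n. 0) \<longlonglongrightarrow> a * axis 2 1 $ (2::2)"
    using tendsto_mult[OF tendsto_const[of a] ym_lim[of 2]] by (simp only:)
  then have "a * axis 2 1 $ (2::2) = 0"
    by (simp add: LIMSEQ_const_iff)
  with b show ?thesis by (simp add: axis_def)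
qed

end

section \<open>Solutions of the original system\<close>

lemma prod_int_interval_shift:
  "(\<Prod>j\<in>{M..<M + int k}. f j) = (\<Prod>j<k. f (M + int j))"
proof (induction k)
  case (Suc k)
  have "{M..<M + int (Suc k)} = insert (M + int k) {M..<M + int k}" by auto
  with Suc show ?case by (simp add: mult.commute)
qed simp

theorem theorem6p1:
  fixes K :: "complex set" and M :: int
    and Y C D :: "int \<Rightarrow> complex \<Rightarrow> complex^2^2"
    and lp lm :: "int \<Rightarrow> complex \<Rightarrow> complex"
    and Cinf Dinf :: "complex \<Rightarrow> complex^2^2"
  assumes "compact K" and "interior K \<noteq> {}"
    and "\<And>n z. n \<ge> M \<Longrightarrow> z \<in> K \<Longrightarrow> invertible (Y n z)"
    and "\<And>n. n \<ge> M \<Longrightarrow> continuous_on K (Y n) \<and> mat_holomorphic_on (Y n) (interior K)"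
    and "\<And>n z. n \<ge> M \<Longrightarrow> z \<in> K \<Longrightarrow> invertible (C n z)"
    and "\<And>n z. n \<ge> M \<Longrightarrow> z \<in> K \<Longrightarrow> Y n z = C n z ** D n z ** matrix_inv (C n z)"
    and "\<And>n. n \<ge> M \<Longrightarrow> continuous_on K (C n) \<and> mat_holomorphic_on (C n) (interior K)"
    and "\<And>n. n \<ge> M \<Longrightarrow> continuous_on K (D n) \<and> mat_holomorphic_on (D n) (interior K)"
    and "D1 M K C"
    and "\<And>n z. n \<ge> M \<Longrightarrow> z \<in> K \<Longrightarrow>
           D n z = diag2 (lp n z) (lm n z) \<and> norm (lp n z) \<ge> norm (lm n z)"
    and "\<And>z. z \<in> K \<Longrightarrow> invertible (Cinf z) \<and> invertible (Dinf z)"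
    and "((\<lambda>n. sup_norm K (\<lambda>z. C n z - Cinf z)) \<longlongrightarrow> 0) at_top"
    and "((\<lambda>n. sup_norm K (\<lambda>z. D n z - Dinf z)) \<longlongrightarrow> 0) at_top"
    and "(INF z\<in>K. ratio_prod M lp lm z) = \<infinity> \<or> (SUP z\<in>K. ratio_prod M lp lm z) < \<infinity>"
  shows "\<exists>\<Phi>m \<Phi>p :: int \<Rightarrow> complex \<Rightarrow> complex^2.
      (\<forall>n\<ge>M. vec_holomorphic_on (\<Phi>m n) (interior K) \<and> continuous_on K (\<Phi>m n) \<and>
             vec_holomorphic_on (\<Phi>p n) (interior K) \<and> continuous_on K (\<Phi>p n)) \<and>
      (\<forall>z\<in>K. solution_from M (\<lambda>n. Y n z) (\<lambda>n. \<Phi>m n z) \<and>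
             solution_from M (\<lambda>n. Y n z) (\<lambda>n. \<Phi>p n z) \<and>
             lin_indep_from M (\<lambda>n. \<Phi>m n z) (\<lambda>n. \<Phi>p n z)) \<and>
      ((\<lambda>n. sup_norm K (\<lambda>z. inverse (\<Prod>j\<in>{M..<n}. lp j z) *s \<Phi>p n z - Cinf z *v axis 1 1))
         \<longlongrightarrow> 0) at_top \<and>
      ((\<lambda>n. sup_norm K (\<lambda>z. inverse (\<Prod>j\<in>{M..<n}. lm j z) *s \<Phi>m n z - Cinf z *v axis 2 1))
         \<longlongrightarrow> 0) at_top"
proof -
  note cpt = assms(1) and int_K = assms(2) and Y_inv = assms(3) and C_inv = assms(5)
    and Y_eq = assms(6) and C_hol = assms(7) and D_hol = assms(8) and C_D1 = assms(9)
    and D_eq = assms(10) and Cinf_inv = assms(11) and C_lim = assms(12) and ratio = assms(14)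
  have K_ne: "K \<noteq> {}" using int_K interior_subset by blast
  have M: "M \<le> M + int k" for k by simp
  define c where "c k = C (M + int k)" for k
  define p where "p k = lp (M + int k)" for k
  define m where "m k = lm (M + int k)" for k
  have l_nz: "lp n z \<noteq> 0 \<and> lm n z \<noteq> 0" if "n \<ge> M" "z \<in> K" for n z
  proof -
    have "det (C n z ** D n z ** matrix_inv (C n z)) \<noteq> 0"
      using Y_inv[OF that] Y_eq[OF that] by (simp add: invertible_det_nz)
    then have "invertible (D n z)"
      by (simp add: det_mul invertible_det_nz)
    then show ?thesis
      using D_eq[OF that] by (simp add: invertible_diag2)
  qed
  have hol_l: "hol_cont K (lp n)" "hol_cont K (lm n)" if "n \<ge> M" for n
  proof -
    have D: "hol_cont K (\<lambda>z. D n z $ i $ j)" for i j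
      using hol_cont_matI D_hol[OF that] unfolding hol_cont_mat_def by blast
    have "hol_cont K (lp n) \<longleftrightarrow> hol_cont K (\<lambda>z. D n z $ 1 $ 1)"
      by (rule hol_cont_cong) (simp add: D_eq that diag2_def)
    moreover have "hol_cont K (lm n) \<longleftrightarrow> hol_cont K (\<lambda>z. D n z $ 2 $ 2)"
      by (rule hol_cont_cong) (simp add: D_eq that diag2_def)
    ultimately show "hol_cont K (lp n)" "hol_cont K (lm n)" using D by blast+
  qed
  have hol_C: "hol_cont_mat K (C n)" if "n \<ge> M" for n
    using C_hol[OF that] hol_cont_matI by blast

  have to_int: "filterlim (\<lambda>k. M + int k) at_top sequentially"
    unfolding filterlim_at_top eventually_sequentially
  proof
    show "\<exists>N. \<forall>k\<ge>N. Z \<le> M + int k" for Z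
      by (rule exI[of _ "nat (Z - M)"]) auto
  qed
  have to_nat: "filterlim (\<lambda>n. nat (n - M)) sequentially at_top"
    unfolding filterlim_at_top
  proof
    show "\<forall>\<^sub>F n in at_top. Z \<le> nat (n - M)" for Z
      using eventually_ge_at_top[of "M + int Z"] by eventually_elim auto
  qed

  have c_lim: "uniform_limit K c Cinf sequentially"
    using filterlim_compose[OF C_lim[unfolded sup_norm_tendsto_0_iff] to_int]
    by (simp add: c_def[abs_def])
  have c_cont: "continuous_on K (c k)" for k
    using C_hol[OF M] by (simp add: c_def)
  have Cinf_cont: "continuous_on K Cinf"
    using c_cont by (intro uniform_limit_theorem[OF _ c_lim]) auto
  have Cinf_bounded: "bounded ((\<lambda>z. Cinf z $ i $ j) ` K)" "bounded (Cinf ` K)" for i j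
    by (intro compact_imp_bounded compact_continuous_image cpt Cinf_cont continuous_on_component)+
  have ij_lim: "uniform_limit K (\<lambda>k z. c k z $ i $ j) (\<lambda>z. Cinf z $ i $ j) sequentially" for i j
    by (rule bounded_linear.uniform_limit[OF bounded_linear_vec_nth
        bounded_linear.uniform_limit[OF bounded_linear_vec_nth c_lim]])
  have "uniform_limit K (\<lambda>k z. det (c k z)) (\<lambda>z. det (Cinf z)) sequentially"
    unfolding det_2 by (intro uniform_limit_minus uniform_lim_mult ij_lim Cinf_bounded)
  moreover have "continuous_on K (\<lambda>z. det (c k z))" for k
    using hol_cont_det[OF hol_C[OF M]] by (simp add: c_def hol_cont_def)
  ultimately obtain \<delta> where \<delta>: "\<delta> > 0" "\<And>k z. z \<in> K \<Longrightarrow> \<delta> \<le> norm (det (c k z))"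
    using C_inv[OF M] Cinf_inv
    by (rule_tac uniform_limit_bounded_below[OF cpt]) (auto simp: c_def invertible_det_nz)
  \<comment> \<open>The determinants are bounded away from 0, uniformly in \<open>k\<close> and \<open>z\<close>; this bounds the inverses.\<close>
  obtain b where b: "\<And>n z. n \<ge> M \<Longrightarrow> z \<in> K \<Longrightarrow> norm (C n z) \<le> b"
    using C_D1 unfolding D1_def by blast
  have inv_le: "norm (matrix_inv (c k z)) \<le> b / \<delta>" if z: "z \<in> K" for k z
    unfolding c_def norm_matrix_inv_2[OF C_inv[OF M z]]
    using b[OF M z] order_trans[OF norm_ge_zero b[OF M z]] \<delta>(1) \<delta>(2)[OF z]
    by (intro frac_le) (auto simp: c_def)

  define s where "s k = sup_norm K (\<lambda>z. C (M + int k + 1) z - C (M + int k) z)" for k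
  have s_sum: "suminf s < top"
    using C_D1 by (simp add: D1_def s_def[abs_def])
  have "s k \<le> suminf s" for k
    using sum_le_suminf[of s "{k}"] by (simp add: summableI)
  then have s_fin: "s k = ennreal (enn2real (s k))" for k
    using s_sum by (metis ennreal_enn2real order_le_less_trans)
  have s_summable: "summable (\<lambda>k. enn2real (s k))"
    using s_sum s_fin by (intro summable_suminf_not_top) (auto simp flip: s_fin)
  have diff_le: "norm (c (Suc k) z - c k z) \<le> enn2real (s k)" if "z \<in> K" for k z
  proof -
    have "ennreal (norm (C (M + int k + 1) z - C (M + int k) z)) \<le> s k"
      unfolding s_def sup_norm_def by (rule SUP_upper[OF that])
    then have "ennreal (norm (c (Suc k) z - c k z)) \<le> ennreal (enn2real (s k))"
      using s_fin by (simp add: c_def add_ac)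
    then show ?thesis by simp
  qed

  interpret diagonalised_system K c p m "b / \<delta>" "\<lambda>k. enn2real (s k)"
  proof
    show "norm (m n z) \<le> norm (p n z)" if "z \<in> K" for n z
      using D_eq[OF M that] by (simp add: m_def p_def)
    show "m n z \<noteq> 0" if "z \<in> K" for n z
      using l_nz[OF M that] by (simp add: m_def)
    show "invertible (c n z)" if "z \<in> K" for n z
      using C_inv[OF M that] by (simp add: c_def)
    show "hol_cont_mat K (c n)" "hol_cont K (p n)" "hol_cont K (m n)" for n
      using hol_C[OF M] hol_l[OF M] by (simp_all add: c_def p_def m_def)
  qed (fact K_ne inv_le diff_le s_summable)+

  have ratio_ge_1: "1 \<le> norm (p k z / m k z)" if "z \<in> K" for k z
    using lm_le[OF that, of k] lm_nz[OF that, of k] by (simp add: norm_divide)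
  have ratio_prod_eq: "ratio_prod M lp lm z = (\<Prod>k. ennreal (norm (p k z / m k z)))" for z
    by (simp add: ratio_prod_def p_def m_def)
  obtain ym where ym: "normalised_solution m ym 2" using recessive_solution by blast
  have "\<exists>y. normalised_solution p y 1"
    using ratio
  proof
    assume sup: "(SUP z\<in>K. ratio_prod M lp lm z) < \<infinity>"
    show ?thesis
    proof (rule dominant_solution_if_bounded)
      fix n z assume z: "z \<in> K"
      have "ennreal (\<Prod>j<n. norm (p j z / m j z)) \<le> ratio_prod M lp lm z"
        unfolding ratio_prod_eq by (rule prodinf_ennreal_ge_1(2)[OF ratio_ge_1[OF z]])
      also have "\<dots> \<le> (SUP z\<in>K. ratio_prod M lp lm z)"
        using z by (rule SUP_upper)
      also have "\<dots> = ennreal (enn2real (SUP z\<in>K. ratio_prod M lp lm z))"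
        using sup by simp
      finally show "(\<Prod>j<n. norm (p j z / m j z)) \<le> enn2real (SUP z\<in>K. ratio_prod M lp lm z)"
        by simp
    qed
  next
    assume inf: "(INF z\<in>K. ratio_prod M lp lm z) = \<infinity>"
    show ?thesis
    proof (rule dominant_solution_if_unbounded)
      fix k and \<epsilon> :: real assume \<epsilon>: "\<epsilon> > 0"
      \<comment> \<open>These products equal \<open>P k / P (k + n)\<close> for the partial products \<open>P\<close> of
        \<open>\<bar>\<lambda>\<^sup>+/\<lambda>\<^sup>-\<bar>\<close>, so they decrease to 0 at every point of \<open>K\<close>.\<close>
      define f where "f n z = (\<Prod>j\<in>{k..<k + n}. norm (m j z / p j z))" for n z
      have "\<exists>n0. \<forall>n\<ge>n0. \<forall>z\<in>K. f n z < \<epsilon>"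
      proof (rule decreasing_to_zero_uniformly[OF cpt _ _ _ \<epsilon>])
        show "continuous_on K (f n)" for n
          unfolding f_def using hol_lm hol_lp lp_nz
          by (auto simp: hol_cont_def intro!: continuous_on_prod continuous_on_norm continuous_on_divide)
        show "f (Suc n) z \<le> f n z" if z: "z \<in> K" for n z
        proof -
          have "norm (m (k + n) z / p (k + n) z) \<le> 1"
            using lm_le[OF z, of "k + n"] lp_nz[OF z, of "k + n"] by (simp add: norm_divide)
          moreover have "0 \<le> f n z" unfolding f_def by (intro prod_nonneg) auto
          ultimately show ?thesis
            using mult_left_mono[of "norm (m (k + n) z / p (k + n) z)" 1 "f n z"] by (simp add: f_def)
        qed
        show "(\<lambda>n. f n z) \<longlonglongrightarrow> 0" if z: "z \<in> K" for z
        proof -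
          define P where "P n = (\<Prod>j<n. norm (p j z / m j z))" for n
          have P_pos: "P n > 0" for n
            unfolding P_def using lp_nz[OF z] lm_nz[OF z] by (intro prod_pos) auto
          have "\<infinity> \<le> ratio_prod M lp lm z"
            unfolding inf[symmetric] using z by (rule INF_lower)
          then have "(\<lambda>n. ennreal (P n)) \<longlonglongrightarrow> top"
            using prodinf_ennreal_ge_1(1)[of "\<lambda>j. norm (p j z / m j z)", OF ratio_ge_1[OF z]]
            by (simp add: P_def ratio_prod_eq top_unique)
          then have "filterlim P at_top sequentially"
            by (simp add: ennreal_tendsto_top_eq_at_top)
          then have "filterlim (\<lambda>n. P (n + k)) at_top sequentially"
            by (rule filterlim_compose) (rule filterlim_add_const_nat_at_top)
          then have "(\<lambda>n. P k * inverse (P (n + k))) \<longlonglongrightarrow> P k * 0"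
            by (intro tendsto_mult tendsto_const tendsto_inverse_0_at_top)
          moreover have "f n z = P k * inverse (P (n + k))" for n
          proof (induction n)
            case 0
            show ?case using P_pos[of k] by (simp add: f_def)
          next
            case (Suc n)
            have "f (Suc n) z = f n z * norm (m (n + k) z / p (n + k) z)"
              by (simp add: f_def add.commute)
            moreover have "norm (m (n + k) z / p (n + k) z) = inverse (norm (p (n + k) z / m (n + k) z))"
              by (simp add: norm_divide)
            moreover have "P (Suc n + k) = P (n + k) * norm (p (n + k) z / m (n + k) z)"
              by (simp add: P_def)
            ultimately show ?case
              using Suc by (simp only: inverse_mult_distrib mult.assoc)
          qed
          ultimately show ?thesis by simp
        qed
      qed
      then obtain n0 where n0: "\<And>n z. n \<ge> n0 \<Longrightarrow> z \<in> K \<Longrightarrow> f n z < \<epsilon>" by blast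
      have "(\<Prod>j\<in>{k..<n}. norm (m j z / p j z)) < \<epsilon>" if "n \<ge> k + n0" "z \<in> K" for n z
        using n0[of "n - k" z] that by (simp add: f_def)
      then show "\<exists>n0. \<forall>n\<ge>n0. \<forall>z\<in>K. (\<Prod>j\<in>{k..<n}. norm (m j z / p j z)) < \<epsilon>" by blast
    qed
  qed
  then obtain yp where yp: "normalised_solution p yp 1" by blast

  define \<Phi> where "\<Phi> l y n z = (\<Prod>j\<in>{M..<n}. l j z) *s (C n z *v y (nat (n - M)) z)"
    for l :: "int \<Rightarrow> complex \<Rightarrow> complex" and y :: "nat \<Rightarrow> complex \<Rightarrow> complex^2" and n z
  have \<Phi>_shift: "\<Phi> l y (M + int k) z = (\<Prod>j<k. l (M + int j) z) *s (c k z *v y k z)" for l y k z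
    by (simp add: \<Phi>_def c_def prod_int_interval_shift)
  have shift_iff: "(\<forall>n\<ge>M. Q n) \<longleftrightarrow> (\<forall>k. Q (M + int k))" for Q
  proof
    assume Q: "\<forall>k. Q (M + int k)"
    show "\<forall>n\<ge>M. Q n"
    proof (intro allI impI)
      fix n assume "n \<ge> M"
      then have "n = M + int (nat (n - M))" by simp
      then show "Q n" using Q by metis
    qed
  qed auto
  have \<Phi>_hol: "vec_holomorphic_on (\<Phi> l y n) (interior K) \<and> continuous_on K (\<Phi> l y n)"
    if y: "normalised_solution l' y i" and l: "\<And>n. n \<ge> M \<Longrightarrow> hol_cont K (l n)" and n: "n \<ge> M" for l l' y i n
  proof -
    have "hol_cont_vec K (y k)" for k using y by (simp add: normalised_solution_def)
    then have "hol_cont_vec K (\<Phi> l y n)"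
      unfolding \<Phi>_def using n
      by (intro hol_cont_vec_scale hol_cont_prod hol_cont_vec_mult hol_C) (auto intro: l)
    then show ?thesis by (simp add: hol_cont_vec_iff)
  qed
  have \<Phi>_sol: "solution_from M (\<lambda>n. Y n z) (\<lambda>n. \<Phi> l y n z)"
    if y: "normalised_solution (\<lambda>k. l (M + int k)) y i" and z: "z \<in> K" for l y i z
    unfolding solution_from_def shift_iff
  proof
    fix k
    let ?L = "\<Prod>j<k. l (M + int j) z"
    have "\<Phi> l y (M + int k + 1) z = \<Phi> l y (M + int (Suc k)) z" by (simp add: add_ac)
    also have "\<dots> = ?L *s (l (M + int k) z *s (c (Suc k) z *v y (Suc k) z))"
      unfolding \<Phi>_shift by (simp add: vector_smult_assoc)
    also have "l (M + int k) z *s (c (Suc k) z *v y (Suc k) z) = c k z *v (diag2 (p k z) (m k z) *v y k z)"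
      using y z by (simp add: normalised_solution_def)
    also have "\<dots> = Y (M + int k) z *v (c k z *v y k z)"
      using D_eq[OF M z] Y_eq[OF M z] matrix_inv_cancel(1)[OF C_inv[OF M z]]
      by (simp add: c_def p_def m_def matrix_vector_mul_assoc[symmetric])
    also have "?L *s (Y (M + int k) z *v (c k z *v y k z)) = Y (M + int k) z *v \<Phi> l y (M + int k) z"
      unfolding \<Phi>_shift by (simp add: vec.scale)
    finally show "\<Phi> l y (M + int k + 1) z = Y (M + int k) z *v \<Phi> l y (M + int k) z" .
  qed
  have \<Phi>_lim: "((\<lambda>n. sup_norm K (\<lambda>z. inverse (\<Prod>j\<in>{M..<n}. l j z) *s \<Phi> l y n z - Cinf z *v axis i 1))
      \<longlongrightarrow> 0) at_top"
    if y: "normalised_solution l' y i" and l: "\<And>n z. n \<ge> M \<Longrightarrow> z \<in> K \<Longrightarrow> l n z \<noteq> 0" for l l' y i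
    unfolding sup_norm_tendsto_0_iff
  proof -
    have "uniform_limit K y (\<lambda>_. axis i 1) sequentially"
      using y by (simp add: normalised_solution_def)
    then have "uniform_limit K (\<lambda>k z. c k z *v y k z) (\<lambda>z. Cinf z *v axis i 1) sequentially"
      using Cinf_bounded(2) K_ne
      by (intro bounded_bilinear.bounded_uniform_limit[OF bounded_bilinear_matrix_vector_mult] c_lim)
        (auto simp: image_constant_conv)
    from filterlim_compose[OF this to_nat]
    have lim: "uniform_limit K (\<lambda>n z. c (nat (n - M)) z *v y (nat (n - M)) z) (\<lambda>z. Cinf z *v axis i 1) at_top" .
    have "\<forall>\<^sub>F n in at_top. \<forall>z\<in>K. c (nat (n - M)) z *v y (nat (n - M)) z
        = inverse (\<Prod>j\<in>{M..<n}. l j z) *s \<Phi> l y n z"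
      using eventually_ge_at_top[of M]
    proof eventually_elim
      case (elim n)
      show ?case
      proof
        fix z assume "z \<in> K"
        then have "(\<Prod>j\<in>{M..<n}. l j z) \<noteq> 0" using l by simp
        then show "c (nat (n - M)) z *v y (nat (n - M)) z = inverse (\<Prod>j\<in>{M..<n}. l j z) *s \<Phi> l y n z"
          using elim by (simp add: \<Phi>_def c_def vector_smult_assoc)
      qed
    qed
    from uniform_limit_cong[OF this, of "\<lambda>z. Cinf z *v axis i 1" "\<lambda>z. Cinf z *v axis i 1"] lim
    show "uniform_limit K (\<lambda>n z. inverse (\<Prod>j\<in>{M..<n}. l j z) *s \<Phi> l y n z) (\<lambda>z. Cinf z *v axis i 1) at_top"
      by simp
  qed
  show ?thesis
  proof (rule exI[of _ "\<Phi> lm ym"], rule exI[of _ "\<Phi> lp yp"], intro conjI ballI)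
    show "\<forall>n\<ge>M. vec_holomorphic_on (\<Phi> lm ym n) (interior K) \<and> continuous_on K (\<Phi> lm ym n) \<and>
        vec_holomorphic_on (\<Phi> lp yp n) (interior K) \<and> continuous_on K (\<Phi> lp yp n)"
      using \<Phi>_hol[OF ym, of lm] \<Phi>_hol[OF yp, of lp] hol_l by blast
    fix z assume z: "z \<in> K"
    show "solution_from M (\<lambda>n. Y n z) (\<lambda>n. \<Phi> lm ym n z)"
      using \<Phi>_sol[of lm] ym z by (simp add: m_def[abs_def])
    show "solution_from M (\<lambda>n. Y n z) (\<lambda>n. \<Phi> lp yp n z)"
      using \<Phi>_sol[of lp] yp z by (simp add: p_def[abs_def])
    show "lin_indep_from M (\<lambda>n. \<Phi> lm ym n z) (\<lambda>n. \<Phi> lp yp n z)"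
      unfolding lin_indep_from_def shift_iff \<Phi>_shift
      using normalised_solutions_independent[OF ym yp z] unfolding m_def p_def by blast
  next
    show "((\<lambda>n. sup_norm K (\<lambda>z. inverse (\<Prod>j\<in>{M..<n}. lp j z) *s \<Phi> lp yp n z - Cinf z *v axis 1 1))
         \<longlongrightarrow> 0) at_top"
      using l_nz by (intro \<Phi>_lim[OF yp]) blast
    show "((\<lambda>n. sup_norm K (\<lambda>z. inverse (\<Prod>j\<in>{M..<n}. lm j z) *s \<Phi> lm ym n z - Cinf z *v axis 2 1))
         \<longlongrightarrow> 0) at_top"
      using l_nz by (intro \<Phi>_lim[OF ym]) blast
  qed
qed

end
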